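(* Let $p$ be an odd prime and for a $p$-adic integer $x$ and $n\in\mathbb{N}$ put $$t_n(x)=\sum_{k=0}^n\binom{n}{k}\binom{x}{k}\binom{x+k}{k}2^k.$$ Then for any $p$-adic integer $x\not\equiv-1/2\pmod p$, $$\sum_{n=0}^{p-1}(n+1)t_n(x)^2\equiv\frac{p}{4}-\frac{(-1)^{\langle x\rangle_p}(2x^2+2x-1)(p+2(x-\langle x\rangle_p))}{8x+4}\pmod{p^2},$$ and for any $p$-adic integer $x\equiv-1/2\pmod p$, $$\sum_{n=0}^{p-1}(n+1)t_n(x)^2\equiv\frac{p}{4}+\frac{3}{8}\left(\frac{-1}{p}\right)\pmod{p^2}.$$
   Context: For a $p$-adic integer $x$ and $k\in\mathbb{N}$, $\binom{x}{k}=x(x-1)\cdots(x-k+1)/k!$. $\langle x\rangle_p$ denotes the least nonnegative residue of $x$ modulo $p$, i.e. the unique integer in $\{0,1,\dots,p-1\}$ congruent to $x$ modulo $p$. $\left(\frac{\cdot}{p}\right)$ is the Legendre symbol. Congruences are understood in $\mathbb{Z}_p$. *)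

theory Defs
  imports
    "HOL-Computational_Algebra.Polynomial_Factorial"
    "HOL-Number_Theory.Number_Theory"
    "Berlekamp_Zassenhaus.Finite_Field"
begin

text \<open>
  The ring of \<open>p\<close>-adic integers is the inverse limit of \<open>\<int>/p\<^sup>n\<int>\<close>: an element is a
  compatible sequence of residues, the \<open>n\<close>-th one being represented in \<open>{0..<p\<^sup>n}\<close>. The prime
  \<open>p\<close> is the cardinality of the index type \<open>'p\<close>.
\<close>

typedef (overloaded) ('p :: prime_card) padic_int =
  "{x :: nat \<Rightarrow> int. \<forall>n. x n \<in> {0..<int CARD('p) ^ n} \<and> x (Suc n) mod int CARD('p) ^ n = x n}"
  morphisms padic_residue Abs_padic_int
  by (rule exI[of _ "\<lambda>_. 0"]) (auto simp: prime_gt_0_nat[OF prime_card])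

setup_lifting type_definition_padic_int

lemma card_pow_pos [simp]: "0 < int CARD('p :: prime_card) ^ n"
  using prime_gt_0_nat[OF prime_card[where 'a = 'p]] by simp

lemma mod_card_pow_Suc:
  "(a :: int) mod int CARD('p :: prime_card) ^ Suc n mod int CARD('p) ^ n = a mod int CARD('p) ^ n"
  by (rule mod_mod_cancel) (simp add: le_imp_power_dvd)

instantiation padic_int :: (prime_card) comm_ring_1
begin

lift_definition zero_padic_int :: "'a padic_int" is "\<lambda>_. 0"
  by auto

lift_definition one_padic_int :: "'a padic_int" is "\<lambda>n. 1 mod int CARD('a) ^ n"
  by (simp only: mod_card_pow_Suc) auto

lift_definition plus_padic_int :: "'a padic_int \<Rightarrow> 'a padic_int \<Rightarrow> 'a padic_int"
  is "\<lambda>x y n. (x n + y n) mod int CARD('a) ^ n"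
  by (simp only: mod_card_pow_Suc) (auto, metis mod_add_eq)

lift_definition minus_padic_int :: "'a padic_int \<Rightarrow> 'a padic_int \<Rightarrow> 'a padic_int"
  is "\<lambda>x y n. (x n - y n) mod int CARD('a) ^ n"
  by (simp only: mod_card_pow_Suc) (auto, metis mod_diff_eq)

lift_definition uminus_padic_int :: "'a padic_int \<Rightarrow> 'a padic_int"
  is "\<lambda>x n. (- x n) mod int CARD('a) ^ n"
  by (simp only: mod_card_pow_Suc) (auto, metis mod_minus_eq)

lift_definition times_padic_int :: "'a padic_int \<Rightarrow> 'a padic_int \<Rightarrow> 'a padic_int"
  is "\<lambda>x y n. (x n * y n) mod int CARD('a) ^ n"
  by (simp only: mod_card_pow_Suc) (auto, metis mod_mult_eq)

instance
proof
  fix a b c :: "'a padic_int"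
  show "a * b * c = a * (b * c)"
    by transfer (simp add: fun_eq_iff mod_simps mult.assoc)
  show "a * b = b * a"
    by transfer (simp add: mult.commute)
  show "1 * a = a"
    by transfer (auto simp: fun_eq_iff mod_simps)
  show "a + b + c = a + (b + c)"
    by transfer (simp add: fun_eq_iff mod_simps add.assoc)
  show "a + b = b + a"
    by transfer (simp add: add.commute)
  show "0 + a = a"
    by transfer (auto simp: fun_eq_iff)
  show "- a + a = 0"
    by transfer (simp add: fun_eq_iff mod_simps)
  show "a - b = a + - b"
    by transfer (simp add: fun_eq_iff mod_simps)
  show "(a + b) * c = a * c + b * c"
    by transfer (simp add: fun_eq_iff mod_simps distrib_right)
  show "(0 :: 'a padic_int) \<noteq> 1"
  proof transfer
    have "(1::int) mod int CARD('a) ^ 1 = 1"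
      using prime_gt_1_nat[OF prime_card[where 'a = 'a]] by simp
    thus "(\<lambda>_. 0) \<noteq> (\<lambda>n. 1 mod int CARD('a) ^ n)"
      by (metis zero_neq_one)
  qed
qed

end

lemma padic_residue_mod:
  "m \<le> n \<Longrightarrow> padic_residue (x :: 'p :: prime_card padic_int) n mod int CARD('p) ^ m = padic_residue x m"
proof (induction n rule: dec_induct)
  case base
  show ?case using padic_residue[of x] by auto
next
  case (step n)
  have "padic_residue x (Suc n) mod int CARD('p) ^ m
      = padic_residue x (Suc n) mod int CARD('p) ^ n mod int CARD('p) ^ m"
    using step.hyps by (simp add: mod_mod_cancel le_imp_power_dvd)
  also have "\<dots> = padic_residue x n mod int CARD('p) ^ m"
    using padic_residue[of x] by simp
  finally show ?case using step.IH by simp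
qed

lemma padic_residue_of_nat:
  "padic_residue (of_nat k :: 'p :: prime_card padic_int) n = int k mod int CARD('p) ^ n"
  by (induction k)
    (simp_all add: zero_padic_int.rep_eq plus_padic_int.rep_eq one_padic_int.rep_eq mod_simps)

instance padic_int :: (prime_card) idom
proof
  fix a b :: "'a padic_int"
  let ?p = "int CARD('a)"
  assume "a \<noteq> 0" "b \<noteq> 0"
  then obtain m n where m: "padic_residue a m \<noteq> 0" and n: "padic_residue b n \<noteq> 0"
    by (metis padic_residue_inject zero_padic_int.rep_eq ext)
  have "padic_residue a 0 = 0"
    using padic_residue[of a] by (auto dest!: spec[of _ 0])
  hence "m \<noteq> 0"
    using m by metis
  have a: "\<not> ?p ^ m dvd padic_residue a (m + n)" and b: "\<not> ?p ^ n dvd padic_residue b (m + n)"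
    using m n padic_residue_mod[of m "m + n" a] padic_residue_mod[of n "m + n" b]
    by (auto simp: dvd_eq_mod_eq_0)
  show "a * b \<noteq> 0"
  proof
    assume "a * b = 0"
    hence "padic_residue (a * b) (m + n) = 0"
      by (simp add: zero_padic_int.rep_eq)
    hence "?p ^ (m + n) dvd padic_residue a (m + n) * padic_residue b (m + n)"
      by (simp add: times_padic_int.rep_eq dvd_eq_mod_eq_0)
    hence "?p ^ (m + n - 1) dvd padic_residue a (m + n) * padic_residue b (m + n)"
      by (rule power_le_dvd) simp
    moreover have "prime_elem ?p"
      using prime_card_int[where 'a = 'a] by (rule prime_imp_prime_elem)
    moreover have "m + n = Suc (m + n - 1)"
      using \<open>m \<noteq> 0\<close> by simp
    ultimately show False
      using a b prime_elem_power_dvd_cases by blast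
  qed
qed

instance padic_int :: (prime_card) ring_char_0
proof
  show "inj (of_nat :: nat \<Rightarrow> 'a padic_int)"
  proof (rule injI)
    fix k l :: nat
    assume eq: "(of_nat k :: 'a padic_int) = of_nat l"
    let ?n = "max k l"
    have "?n < CARD('a) ^ ?n"
      using prime_gt_1_nat[OF prime_card[where 'a = 'a]] by (intro power_gt_expt) simp
    hence kl: "k < CARD('a) ^ ?n" "l < CARD('a) ^ ?n"
      by linarith+
    have "int k mod int CARD('a) ^ ?n = int l mod int CARD('a) ^ ?n"
      using eq by (metis padic_residue_of_nat)
    hence "k mod CARD('a) ^ ?n = l mod CARD('a) ^ ?n"
      by (metis of_nat_power of_nat_mod of_nat_eq_iff)
    with kl show "k = l" by simp
  qed
qed

instance fract :: ("{idom, ring_char_0}") field_char_0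
proof
  have "(of_nat k :: 'a fract) = to_fract (of_nat k)" for k
    by (induction k) (simp_all add: to_fract_def One_fract_def Zero_fract_def)
  thus "inj (of_nat :: nat \<Rightarrow> 'a fract)"
    by (auto intro!: injI simp: to_fract_def eq_fract)
qed

text \<open>The field of \<open>p\<close>-adic numbers; \<open>to_fract\<close> is the inclusion of the \<open>p\<close>-adic integers.\<close>

type_synonym 'p padic = "'p padic_int fract"

text \<open>Congruence in \<open>\<int>\<^sub>p\<close>: the difference lies in \<open>m\<int>\<^sub>p\<close>.\<close>

definition padic_cong :: "'p :: prime_card padic \<Rightarrow> 'p padic \<Rightarrow> nat \<Rightarrow> bool" where
  "padic_cong a b m \<longleftrightarrow> (\<exists>z. a - b = of_nat m * to_fract z)"

definition least_residue :: "'p :: prime_card padic_int \<Rightarrow> nat" where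
  "least_residue x = (THE r. r < CARD('p) \<and> padic_cong (to_fract x) (of_nat r) CARD('p))"

lemma padic_residue_1_eq_0_iff:
  fixes x :: "'p :: prime_card padic_int"
  shows "padic_residue x 1 = 0 \<longleftrightarrow> (\<exists>z. x = of_nat CARD('p) * z)"
proof
  let ?p = "int CARD('p)"
  have p: "?p > 0" using card_pow_pos[of 1, where 'p = 'p] by simp
  assume x1: "padic_residue x 1 = 0"
  define f where "f n = padic_residue x (Suc n) div ?p" for n
  have dvd: "?p dvd padic_residue x (Suc n)" for n
    using padic_residue_mod[of 1 "Suc n" x] x1 by (simp add: dvd_eq_mod_eq_0)
  have f: "padic_residue x (Suc n) = ?p * f n" for n
    using dvd[of n] by (simp add: f_def)
  have rep: "padic_residue x n \<in> {0..<?p ^ n}"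
    "padic_residue x (Suc n) mod ?p ^ n = padic_residue x n" for n
    using padic_residue[of x] by auto
  have "f n \<in> {0..<?p ^ n}" for n
    using rep(1)[of "Suc n"] p by (auto simp: f zero_le_mult_iff)
  moreover have "f (Suc n) mod ?p ^ n = f n" for n
  proof -
    have "?p * (f (Suc n) mod ?p ^ n) = ?p * f n"
      using rep(2)[of "Suc n"] by (simp add: f)
    thus ?thesis using p by simp
  qed
  ultimately have "f \<in> {x. \<forall>n. x n \<in> {0..<?p ^ n} \<and> x (Suc n) mod ?p ^ n = x n}"
    by blast
  hence z: "padic_residue (Abs_padic_int f :: 'p padic_int) = f"
    by (rule Abs_padic_int_inverse)
  have "padic_residue (of_nat CARD('p) * Abs_padic_int f :: 'p padic_int) n = padic_residue x n" for n
    by (simp add: times_padic_int.rep_eq padic_residue_of_nat z mod_simps rep(2) flip: f)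
  thus "\<exists>z. x = of_nat CARD('p) * z"
    by (metis padic_residue_inject ext)
next
  assume "\<exists>z. x = of_nat CARD('p) * z"
  thus "padic_residue x 1 = 0"
    by (auto simp: times_padic_int.rep_eq padic_residue_of_nat)
qed

lemma to_fract_of_nat: "to_fract (of_nat k :: 'a :: idom) = of_nat k"
  by (induction k) simp_all

lemma padic_cong_of_nat_iff:
  fixes x :: "'p :: prime_card padic_int"
  assumes "r < CARD('p)"
  shows "padic_cong (to_fract x) (of_nat r) CARD('p) \<longleftrightarrow> padic_residue x 1 = int r"
proof -
  have "padic_cong (to_fract x) (of_nat r) CARD('p) \<longleftrightarrow> (\<exists>z. x - of_nat r = of_nat CARD('p) * z)"
    unfolding padic_cong_def
    by (simp only: to_fract_of_nat[symmetric] to_fract_diff[symmetric] to_fract_mult[symmetric]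
        to_fract_eq_iff)
  also have "\<dots> \<longleftrightarrow> (padic_residue x 1 - int r) mod int CARD('p) = 0"
    by (simp add: padic_residue_1_eq_0_iff[symmetric] minus_padic_int.rep_eq padic_residue_of_nat
        mod_simps)
  also have "\<dots> \<longleftrightarrow> padic_residue x 1 mod int CARD('p) = int r mod int CARD('p)"
    by (simp add: mod_eq_dvd_iff dvd_eq_mod_eq_0)
  also have "padic_residue x 1 mod int CARD('p) = padic_residue x 1"
    using padic_residue_mod[of 1 1 x] by simp
  finally show ?thesis
    using assms by simp
qed

lemma least_residue_eq:
  "least_residue (x :: 'p :: prime_card padic_int) = nat (padic_residue x 1)"
proof -
  have "padic_residue x 1 \<in> {0..<int CARD('p)}"
    using padic_residue[of x] by (auto dest: spec[of _ 1])
  then obtain r where r: "padic_residue x 1 = int r" "r < CARD('p)"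
    by (metis atLeastLessThan_iff nonneg_int_cases of_nat_less_iff)
  hence "least_residue x = r"
    unfolding least_residue_def
    by (intro the_equality) (use padic_cong_of_nat_iff[of _ x] in auto)
  with r show ?thesis by simp
qed

definition t_poly :: "nat \<Rightarrow> 'p :: prime_card padic_int \<Rightarrow> 'p padic" where
  "t_poly n x = (\<Sum>k\<le>n. of_nat (n choose k) * (to_fract x gchoose k)
                   * ((to_fract x + of_nat k) gchoose k) * 2 ^ k)"

end

theory Submission
  imports Defs
begin

text \<open>
  Write \<open>x = a + p y\<close> with \<open>a = \<langle>x\<rangle>\<^sub>p\<close> and let \<open>F x\<close> be the sum in question, a polynomial in \<open>x\<close> with
  \<open>p\<close>-integral coefficients. Modulo \<open>p\<^sup>2\<close> it is affine in \<open>y\<close>, so it is determined by \<open>F a\<close> and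
  \<open>F (a - p)\<close>; since \<open>t\<^sub>n\<close> is invariant under \<open>x \<mapsto> -1 - x\<close>, the latter equals \<open>F (p - 1 - a)\<close>.

  For an integer \<open>0 \<le> a < p\<close> let \<open>P v = \<Sum>\<^sub>k (a choose k) (a + k choose k) v\<^sup>k\<close> be the Legendre polynomial
  shifted to \<open>[-1, 0]\<close>. Expanding \<open>(n + 1) t\<^sub>n = \<Sum>\<^sub>k f\<^sub>k (n choose k)\<close> and
  \<open>t\<^sub>n = \<Sum>\<^sub>l g\<^sub>l (-1 - n choose l)\<close>, the generating polynomials are \<open>f w = (1 + w) (w P(2w))'\<close> and
  \<open>g w = (-1)\<^sup>a P(2w + 1)\<close>. Because \<open>(k + l + 1) \<Sum>\<^sub>n\<^sub><\<^sub>p (n choose k) (n + l choose l)\<close> equals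
  \<open>p (p - 1 choose k) (p + l choose l)\<close>, the sum is congruent modulo \<open>p\<^sup>2\<close> to \<open>p\<close> times the integral of
  \<open>f g\<close> over \<open>[-1, 0]\<close>. Folding the interval \<open>[-2, 0]\<close> of \<open>v = 2w\<close> at its midpoint turns this into an
  integral of \<open>P v\<close> against a polynomial in \<open>v\<close>, \<open>P (v + 1)\<close> and \<open>P' (v + 1)\<close>, which the orthogonality
  relations evaluate, as \<open>P (v + 1) = P v + P' v + \<dots>\<close> with remainder of degree at most \<open>a - 2\<close>.
\<close>

section \<open>Integration of polynomials over the interval from -1 to 0\<close>

text \<open>The linear functional on polynomials with value \<open>u k\<close> at the k-th power of
  the variable. Integration and both kinds of binomial expansion are instances of it.\<close>

definition coeff_pairing :: "(nat \<Rightarrow> 'a :: comm_ring_1) \<Rightarrow> 'a poly \<Rightarrow> 'a" where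
  "coeff_pairing u p = (\<Sum>k\<le>degree p. coeff p k * u k)"

lemma coeff_pairing_altdef:
  "degree p \<le> n \<Longrightarrow> coeff_pairing u p = (\<Sum>k\<le>n. coeff p k * u k)"
  unfolding coeff_pairing_def by (intro sum.mono_neutral_left) (auto simp: coeff_eq_0)

lemma coeff_pairing_0 [simp]: "coeff_pairing u 0 = 0"
  by (simp add: coeff_pairing_def)

lemma coeff_pairing_add: "coeff_pairing u (p + q) = coeff_pairing u p + coeff_pairing u q"
  using degree_add_le_max[of p q]
  by (simp add: coeff_pairing_altdef[of _ "max (degree p) (degree q)"] sum.distrib distrib_right)

lemma coeff_pairing_smult [simp]: "coeff_pairing u (smult c p) = c * coeff_pairing u p"
  by (simp add: coeff_pairing_altdef[of _ "degree p"] degree_smult_le sum_distrib_left mult_ac)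

lemma coeff_pairing_pCons: "coeff_pairing u (pCons c p) = c * u 0 + coeff_pairing (\<lambda>k. u (Suc k)) p"
  by (simp add: coeff_pairing_altdef[of _ "Suc (degree p)"] degree_pCons_le sum.atMost_Suc_shift
      coeff_pairing_def del: sum.atMost_Suc)

lemma coeff_pairing_monom: "coeff_pairing u (monom c n) = c * u n"
  by (simp add: coeff_pairing_altdef[of _ n] degree_monom_le if_distrib[of "\<lambda>x. x * _"]
      cong: if_cong)

lemma coeff_pairing_sum: "coeff_pairing u (sum f A) = (\<Sum>i\<in>A. coeff_pairing u (f i))"
  by (induction A rule: infinite_finite_induct) (simp_all add: coeff_pairing_add)

lemma coeff_pairing_mult:
  "coeff_pairing u (p * q)
     = (\<Sum>k\<le>degree p. \<Sum>l\<le>degree q. coeff p k * coeff q l * u (k + l))"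
proof -
  have "p * q = (\<Sum>k\<le>degree p. monom (coeff p k) k) * (\<Sum>l\<le>degree q. monom (coeff q l) l)"
    by (simp add: poly_as_sum_of_monoms)
  also have "\<dots> = (\<Sum>k\<le>degree p. \<Sum>l\<le>degree q. monom (coeff p k * coeff q l) (k + l))"
    by (simp add: sum_product mult_monom)
  finally show ?thesis by (simp add: coeff_pairing_sum coeff_pairing_monom)
qed

text \<open>The integral over \<open>[-1, 0]\<close>.\<close>

definition poly_int :: "'a :: field_char_0 poly \<Rightarrow> 'a" where
  "poly_int = coeff_pairing (\<lambda>k. (- 1) ^ k / of_nat (Suc k))"

lemma poly_int_add: "poly_int (p + q) = poly_int p + poly_int q"
  by (simp add: poly_int_def coeff_pairing_add)

lemma poly_int_smult [simp]: "poly_int (smult c p) = c * poly_int p"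
  by (simp add: poly_int_def)

lemma poly_int_minus: "poly_int (- p) = - poly_int p"
  using poly_int_smult[of "- 1" p] by simp

lemma poly_int_diff: "poly_int (p - q) = poly_int p - poly_int q"
  using poly_int_add[of p "- q"] by (simp add: poly_int_minus)

lemma poly_int_of_nat_mult: "poly_int (of_nat n * p) = of_nat n * poly_int p"
  by (simp add: of_nat_poly)

lemma poly_int_numeral_mult: "poly_int (numeral n * p) = numeral n * poly_int p"
  using poly_int_of_nat_mult[of "numeral n" p] by simp

lemma poly_int_sum: "poly_int (sum f A) = (\<Sum>i\<in>A. poly_int (f i))"
  by (simp add: poly_int_def coeff_pairing_sum)

lemmas poly_int_linear = poly_int_add poly_int_diff poly_int_minus poly_int_of_nat_mult
  poly_int_numeral_mult

text \<open>Fundamental theorem of calculus: the factor k + 1 from differentiation cancels the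
  denominator of the k-th moment. Every integration by parts and every substitution below goes
  through it.\<close>

lemma poly_int_pderiv: "poly_int (pderiv p) = poly p 0 - poly p (- 1)"
proof -
  have "poly_int (pderiv p) = (\<Sum>k\<le>degree p. (- 1) ^ k * coeff p (Suc k))"
    unfolding poly_int_def by (subst coeff_pairing_altdef[of _ "degree p"])
      (simp_all add: degree_pderiv coeff_pderiv mult.commute del: of_nat_Suc)
  moreover have "poly p (- 1) = (\<Sum>k\<le>Suc (degree p). coeff p k * (- 1) ^ k)"
    by (simp add: poly_altdef coeff_eq_0)
  ultimately show ?thesis
    by (simp add: sum.atMost_Suc_shift poly_0_coeff_0 sum_negf mult.commute del: sum.atMost_Suc)
qed

lemma antiderivative_exists: "\<exists>q. pderiv q = (p :: 'a :: field_char_0 poly)"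
proof
  have "pderiv (\<Sum>i\<le>degree p. monom (coeff p i / of_nat (Suc i)) (Suc i))
      = (\<Sum>i\<le>degree p. monom (coeff p i) i)"
    by (simp add: pderiv_sum pderiv_monom del: of_nat_Suc)
  thus "pderiv (\<Sum>i\<le>degree p. monom (coeff p i / of_nat (Suc i)) (Suc i)) = p"
    by (simp add: poly_as_sum_of_monoms)
qed

text \<open>The substitution v -> -1 - v maps [-1, 0] to itself; it is carried out on an
  antiderivative.\<close>

lemma poly_int_reflect: "poly_int (p \<circ>\<^sub>p [:- 1, - 1:]) = poly_int p"
proof -
  obtain q where q: "pderiv q = p" using antiderivative_exists by blast
  have "pderiv (- (q \<circ>\<^sub>p [:- 1, - 1:])) = p \<circ>\<^sub>p [:- 1, - 1:]"
    by (simp add: pderiv_minus pderiv_pcompose q pderiv_pCons)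
  hence "poly_int (p \<circ>\<^sub>p [:- 1, - 1:]) = poly q 0 - poly q (- 1)"
    using poly_int_pderiv[of "- (q \<circ>\<^sub>p [:- 1, - 1:])"] by (simp add: poly_pcompose)
  thus ?thesis by (simp add: poly_int_pderiv flip: q)
qed

text \<open>With v = 2w the left side is the integral over [-2, 0]. This is cut at -1, and the half
  [-2, -1] is carried onto [-1, 0] by v -> -2 - v.\<close>

lemma poly_int_double:
  "2 * poly_int (p \<circ>\<^sub>p [:0, 2:]) = poly_int p + poly_int (p \<circ>\<^sub>p [:- 2, - 1:])"
proof -
  obtain q where q: "pderiv q = p" using antiderivative_exists by blast
  have 1: "pderiv (q \<circ>\<^sub>p [:0, 2:]) = smult 2 (p \<circ>\<^sub>p [:0, 2:])"
    by (simp add: pderiv_pcompose q pderiv_pCons)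
  have 2: "pderiv (q \<circ>\<^sub>p [:- 2, - 1:]) = - (p \<circ>\<^sub>p [:- 2, - 1:])"
    by (simp add: pderiv_pcompose q pderiv_pCons)
  have "2 * poly_int (p \<circ>\<^sub>p [:0, 2:]) = poly q 0 - poly q (- 2)"
    using poly_int_pderiv[of "q \<circ>\<^sub>p [:0, 2:]"] by (simp add: 1 poly_pcompose)
  moreover have "poly_int (p \<circ>\<^sub>p [:- 2, - 1:]) = poly q (- 1) - poly q (- 2)"
    using poly_int_pderiv[of "q \<circ>\<^sub>p [:- 2, - 1:]"]
    by (simp add: 2 poly_int_minus poly_pcompose minus_equation_iff[of "poly_int _"])
  moreover have "poly_int p = poly q 0 - poly q (- 1)"
    using poly_int_pderiv[of q] by (simp add: q)
  ultimately show ?thesis by simp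
qed

section \<open>Shifted Legendre polynomials\<close>

text \<open>In terms of the classical Legendre polynomial P_a this is P_a(2v + 1), normalised to the
  value 1 at v = 0.\<close>

definition shifted_legendre :: "nat \<Rightarrow> 'a :: field_char_0 poly" where
  "shifted_legendre a = (\<Sum>k\<le>a. monom (of_nat ((a choose k) * (a + k choose k))) k)"

lemma coeff_shifted_legendre:
  "coeff (shifted_legendre a) k = of_nat ((a choose k) * (a + k choose k))"
  by (simp add: shifted_legendre_def coeff_sum)

lemma degree_shifted_legendre: "degree (shifted_legendre a) = a"
proof (rule antisym)
  show "degree (shifted_legendre a) \<le> a"
    by (rule degree_le) (simp add: coeff_shifted_legendre)
  show "a \<le> degree (shifted_legendre a)"
    by (rule le_degree) (simp add: coeff_shifted_legendre)
qed

text \<open>Each of the two binomials contributes one factor to the ratio of consecutive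
  coefficients, and (a - k)(a + k + 1) = a(a + 1) - k(k + 1). Comparing coefficients turns this into
  the differential equation below.\<close>

lemma coeff_shifted_legendre_Suc:
  "of_nat (Suc k) ^ 2 * coeff (shifted_legendre a) (Suc k)
     = (of_nat a * (of_nat a + 1) - of_nat k * (of_nat k + 1)) * (coeff (shifted_legendre a) k :: 'a :: field_char_0)"
proof (cases "k \<le> a")
  case True
  have 1: "Suc k * (a choose Suc k) = (a - k) * (a choose k)"
    by (metis binomial_absorb_comp binomial_absorption)
  have 2: "Suc k * (a + Suc k choose Suc k) = (a + k + 1) * (a + k choose k)"
    using Suc_times_binomial_eq[of "a + k" k] by simp
  have "Suc k ^ 2 * ((a choose Suc k) * (a + Suc k choose Suc k))
      = (Suc k * (a choose Suc k)) * (Suc k * (a + Suc k choose Suc k))"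
    unfolding power2_eq_square by (simp only: mult_ac)
  also have "\<dots> = ((a - k) * (a + k + 1)) * ((a choose k) * (a + k choose k))"
    unfolding 1 2 by (simp only: mult_ac)
  finally have "of_nat (Suc k ^ 2 * ((a choose Suc k) * (a + Suc k choose Suc k)))
      = (of_nat (((a - k) * (a + k + 1)) * ((a choose k) * (a + k choose k))) :: 'a)"
    by simp
  thus ?thesis
    using True unfolding coeff_shifted_legendre of_nat_mult of_nat_power
    by (simp add: of_nat_diff algebra_simps)
qed (simp add: coeff_shifted_legendre not_le binomial_eq_0)

text \<open>Legendre's equation in self-adjoint form, which suits integration by parts.\<close>

lemma shifted_legendre_ode:
  "pderiv ([:0, 1, 1:] * pderiv (shifted_legendre a)) = of_nat (a * (a + 1)) * shifted_legendre a"
proof (rule poly_eqI)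
  fix n
  have "coeff (pderiv ([:0, 1, 1:] * pderiv (shifted_legendre a))) n =
     of_nat (Suc n) ^ 2 * coeff (shifted_legendre a) (Suc n)
      + of_nat n * (of_nat n + 1) * coeff (shifted_legendre a) n"
    by (cases n) (simp_all add: coeff_pderiv algebra_simps power2_eq_square coeff_pCons)
  thus "coeff (pderiv ([:0, 1, 1:] * pderiv (shifted_legendre a))) n
      = coeff (of_nat (a * (a + 1)) * shifted_legendre a) n"
    unfolding coeff_shifted_legendre_Suc by (simp add: of_nat_poly algebra_simps)
qed

text \<open>A first-order recurrence whose leading factor never vanishes leaves only the constant
  coefficient free. Hence polynomial solutions of the differential equation are multiples of each
  other.\<close>

lemma poly_eq_smult_if_coeff_recurrence:
  fixes p q :: "'a :: field_char_0 poly"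
  assumes "\<And>k. of_nat (Suc k) ^ 2 * coeff p (Suc k) = r k * coeff p k"
    and "\<And>k. of_nat (Suc k) ^ 2 * coeff q (Suc k) = r k * coeff q k"
    and "coeff q 0 = 1"
  shows "p = smult (coeff p 0) q"
proof (rule poly_eqI)
  fix n
  show "coeff p n = coeff (smult (coeff p 0) q) n"
  proof (induction n)
    case (Suc n)
    have "of_nat (Suc n) ^ 2 * coeff p (Suc n) = r n * coeff p n" by (rule assms)
    also have "\<dots> = coeff p 0 * (r n * coeff q n)" using Suc by simp
    also have "\<dots> = of_nat (Suc n) ^ 2 * (coeff p 0 * coeff q (Suc n))"
      using assms(2)[of n] by simp
    finally have "coeff p (Suc n) = coeff p 0 * coeff q (Suc n)"
      using of_nat_neq_0[of n, where 'a = 'a] by (metis mult_left_cancel power_not_zero)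
    thus ?case by simp
  qed (use assms in simp)
qed

lemma coeff_recurrence_if_ode:
  fixes p :: "'a :: field_char_0 poly"
  assumes "pderiv ([:0, 1, 1:] * pderiv p) = of_nat m * p"
  shows "of_nat (Suc k) ^ 2 * coeff p (Suc k) = (of_nat m - of_nat k * (of_nat k + 1)) * coeff p k"
proof -
  have "coeff (pderiv ([:0, 1, 1:] * pderiv p)) k =
     of_nat (Suc k) ^ 2 * coeff p (Suc k) + of_nat k * (of_nat k + 1) * coeff p k"
    by (cases k) (simp_all add: coeff_pderiv algebra_simps power2_eq_square coeff_pCons)
  thus ?thesis unfolding assms by (simp add: of_nat_poly algebra_simps)
qed

lemma poly_shifted_legendre_0 [simp]: "poly (shifted_legendre a) 0 = 1"
  by (simp add: poly_0_coeff_0 coeff_shifted_legendre)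

text \<open>Since v(v + 1) is invariant under v -> -1 - v, the reflected polynomial solves the same
  equation and is a multiple of the original. The leading coefficients determine the factor.\<close>

lemma shifted_legendre_reflect:
  "shifted_legendre a \<circ>\<^sub>p [:- 1, - 1:] = smult ((- 1) ^ a) (shifted_legendre a :: 'a :: field_char_0 poly)"
proof -
  let ?P = "shifted_legendre a :: 'a poly"
  let ?R = "?P \<circ>\<^sub>p [:- 1, - 1:]"
  have d: "pderiv ?R = - (pderiv ?P \<circ>\<^sub>p [:- 1, - 1:])"
    by (simp add: pderiv_pcompose pderiv_pCons)
  have "[:0, 1, 1:] * pderiv ?R = - (([:0, 1, 1:] * pderiv ?P) \<circ>\<^sub>p [:- 1, - 1:])"
    unfolding d pcompose_mult by (simp add: pcompose_pCons)
  hence "pderiv ([:0, 1, 1:] * pderiv ?R) = pderiv ([:0, 1, 1:] * pderiv ?P) \<circ>\<^sub>p [:- 1, - 1:]"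
    by (simp only: pderiv_minus pderiv_pcompose) (simp add: pderiv_pCons)
  also have "\<dots> = of_nat (a * (a + 1)) * ?R"
    by (simp only: shifted_legendre_ode pcompose_mult) (simp add: of_nat_poly pcompose_pCons)
  finally have ode: "pderiv ([:0, 1, 1:] * pderiv ?R) = of_nat (a * (a + 1)) * ?R" .
  have "?R = smult (coeff ?R 0) ?P"
    by (rule poly_eq_smult_if_coeff_recurrence[OF coeff_recurrence_if_ode[OF ode]
          coeff_recurrence_if_ode[OF shifted_legendre_ode]])
      (simp add: coeff_shifted_legendre)
  moreover have "coeff ?R a = (- 1) ^ a * coeff ?P a"
    using lead_coeff_comp[of "[:- 1, - 1 :: 'a:]" ?P]
    by (simp add: degree_pcompose degree_shifted_legendre)
  moreover have "coeff ?P a \<noteq> 0"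
    by (simp add: coeff_shifted_legendre)
  ultimately show ?thesis
    by (metis coeff_smult mult_right_cancel)
qed

lemma poly_shifted_legendre_minus_1 [simp]: "poly (shifted_legendre a) (- 1) = (- 1) ^ a"
  using arg_cong[OF shifted_legendre_reflect[of a], of "\<lambda>p. poly p 0"] by (simp add: poly_pcompose)

section \<open>Orthogonality and norm of the Legendre polynomials\<close>

text \<open>The operator q -> (v(v + 1) q')' is symmetric for the integral, as v(v + 1) vanishes at
  both endpoints. It is moved from \<open>P\<close> to the monomial.\<close>

lemma poly_int_legendre_monom_recurrence:
  "(of_nat (a * (a + 1)) - of_nat (m * (m + 1))) * poly_int (monom 1 m * shifted_legendre a)
     = (of_nat m ^ 2 * poly_int (monom 1 (m - 1) * shifted_legendre a) :: 'a :: field_char_0)"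
proof -
  let ?P = "shifted_legendre a :: 'a poly" and ?q = "monom 1 m :: 'a poly"
  let ?w = "[:0, 1, 1:] :: 'a poly"
  have "pderiv (?q * (?w * pderiv ?P) - ?w * pderiv ?q * ?P)
      = ?q * pderiv (?w * pderiv ?P) - pderiv (?w * pderiv ?q) * ?P"
    by (simp only: pderiv_diff pderiv_mult) (simp add: algebra_simps)
  hence "poly_int (?q * pderiv (?w * pderiv ?P)) = poly_int (pderiv (?w * pderiv ?q) * ?P)"
    using poly_int_pderiv[of "?q * (?w * pderiv ?P) - ?w * pderiv ?q * ?P"]
    by (simp add: poly_int_diff)
  \<comment> \<open>For m = 0 the index m - 1 is truncated, but its coefficient m^2
    vanishes.\<close>
  moreover have "pderiv (?w * pderiv ?q)
      = of_nat (m * (m + 1)) * monom 1 m + of_nat (m ^ 2) * monom 1 (m - 1)"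
    by (rule poly_eqI, case_tac n; cases m)
      (auto simp: coeff_pderiv coeff_pCons of_nat_poly algebra_simps power2_eq_square)
  ultimately have "poly_int (?q * (of_nat (a * (a + 1)) * ?P))
      = poly_int ((of_nat (m * (m + 1)) * ?q + of_nat (m ^ 2) * monom 1 (m - 1)) * ?P)"
    by (simp only: shifted_legendre_ode)
  hence "of_nat (a * (a + 1)) * poly_int (?q * ?P)
      = of_nat (m * (m + 1)) * poly_int (?q * ?P) + of_nat (m ^ 2) * poly_int (monom 1 (m - 1) * ?P)"
    by (simp only: mult.left_commute[of ?q] distrib_right mult.assoc poly_int_linear)
  thus ?thesis
    by (simp only: left_diff_distrib of_nat_power) simp
qed

text \<open>The recurrence lowers the exponent until m = 0, where its right side is zero. For m < a
  the factor a(a + 1) - m(m + 1) can be cancelled.\<close>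

lemma shifted_legendre_orthogonal_monom:
  "m < a \<Longrightarrow> poly_int (monom 1 m * shifted_legendre a) = (0 :: 'a :: field_char_0)"
proof (induction m)
  case 0
  thus ?case using poly_int_legendre_monom_recurrence[of a 0, where 'a = 'a]
    by (simp del: of_nat_mult of_nat_add of_nat_Suc)
next
  case (Suc m)
  hence "Suc m * (Suc m + 1) < a * (a + 1)" by (intro mult_strict_mono) auto
  hence "(of_nat (a * (a + 1)) - of_nat (Suc m * (Suc m + 1)) :: 'a) \<noteq> 0"
    by (metis eq_iff_diff_eq_0 less_irrefl of_nat_eq_iff)
  thus ?case using poly_int_legendre_monom_recurrence[of a "Suc m", where 'a = 'a] Suc
    by (simp del: of_nat_mult of_nat_add of_nat_Suc)
qed

lemma shifted_legendre_orthogonal: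
  assumes "\<And>k. k \<ge> a \<Longrightarrow> coeff q k = 0"
  shows "poly_int (shifted_legendre a * q) = (0 :: 'a :: field_char_0)"
proof -
  have "(\<Sum>i\<le>degree q. smult (coeff q i) (monom 1 i)) = q"
    by (simp add: smult_monom poly_as_sum_of_monoms)
  hence "poly_int (shifted_legendre a * q)
      = poly_int (shifted_legendre a * (\<Sum>i\<le>degree q. smult (coeff q i) (monom 1 i)))"
    by simp
  also have "\<dots> = (\<Sum>i\<le>degree q. coeff q i * poly_int (monom 1 i * shifted_legendre a))"
    by (simp add: sum_distrib_left poly_int_sum mult.commute[of "shifted_legendre a"])
  also have "\<dots> = 0"
  proof (rule sum.neutral, intro ballI)
    fix i
    show "coeff q i * poly_int (monom 1 i * shifted_legendre a) = 0"
      using shifted_legendre_orthogonal_monom[of i a, where 'a = 'a] assms[of i]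
      by (cases "i < a") auto
  qed
  finally show ?thesis .
qed

text \<open>Integrating the derivative of v P^2 gives 1. In it, v P' may be replaced by a P, because
  v P' - a P has no terms of degree a or more and so is orthogonal to P.\<close>

lemma poly_int_legendre_square:
  "of_nat (2 * a + 1) * poly_int (shifted_legendre a * shifted_legendre a) = (1 :: 'a :: field_char_0)"
proof -
  define P where "P = (shifted_legendre a :: 'a poly)"
  define X where "X = [:0, 1 :: 'a:]"
  have "pderiv (X * (P * P)) = P * P + 2 * (P * (X * pderiv P))"
    unfolding pderiv_mult by (simp add: X_def pderiv_pCons)
  hence "poly_int (P * P) + 2 * poly_int (P * (X * pderiv P)) = poly (X * (P * P)) 0 - poly (X * (P * P)) (- 1)"
    by (metis poly_int_pderiv poly_int_add poly_int_numeral_mult)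
  also have "\<dots> = 1"
    by (simp add: X_def P_def flip: power_mult_distrib)
  finally have "poly_int (P * P) + 2 * poly_int (P * (X * pderiv P)) = 1" .
  moreover have "poly_int (P * (X * pderiv P - of_nat a * P)) = 0"
    unfolding P_def
  proof (rule shifted_legendre_orthogonal)
    fix k assume "a \<le> k"
    thus "coeff (X * pderiv (shifted_legendre a) - of_nat a * shifted_legendre a) k = 0"
      by (cases k) (auto simp: X_def of_nat_poly coeff_pderiv coeff_shifted_legendre le_Suc_eq)
  qed
  hence "poly_int (P * (X * pderiv P)) = of_nat a * poly_int (P * P)"
    by (simp only: right_diff_distrib mult.left_commute[of P "of_nat a"] poly_int_linear) simp
  ultimately show ?thesis by (simp add: algebra_simps flip: P_def)
qed

section \<open>Integrals involving the translate P(v + 1)\<close>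

text \<open>The first two Taylor terms of p(v + 1) are removed, so the degree drops by two. The
  induction rests on the rule that for c + v p the remainder is (1 + v) r + p', where r is the
  remainder of p.\<close>

lemma coeff_shift_diff:
  fixes p :: "'a :: idom poly"
  shows "degree p < k + 2 \<Longrightarrow> coeff (p \<circ>\<^sub>p [:1, 1:] - p - pderiv p) k = 0"
proof (induction p arbitrary: k)
  case (pCons c p)
  show ?case
  proof (cases "p = 0")
    case False
    let ?r = "p \<circ>\<^sub>p [:1, 1:] - p - pderiv p"
    have "pCons c p \<circ>\<^sub>p [:1, 1:] - pCons c p - pderiv (pCons c p) = ?r + pCons 0 ?r + pderiv p"
      by (simp add: pcompose_pCons pderiv_pCons algebra_simps)
    moreover have "degree p < k + 1" using pCons.prems False by simp
    ultimately show ?thesis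
      using pCons.IH[of k] pCons.IH[of "k - 1"]
      by (simp only: coeff_add) (cases k; simp add: coeff_pderiv coeff_eq_0)
  qed (simp add: pderiv_pCons)
qed simp

lemma coeff_linear_factor_mult:
  "coeff ([:c, d:] * p) k = c * coeff p k + (if k = 0 then 0 else d * coeff p (k - 1))"
  by (cases k) auto

text \<open>\<open>Z\<close> is the cofactor of \<open>P\<close> that the folded integral in
  \<open>poly_int_legendre_pairing\<close> produces. Inserting P(v + 1) = P + P' + r and the
  differential equation leaves elementary integrals plus a part orthogonal to
  \<open>P\<close>.\<close>

lemma poly_int_legendre_shift:
  fixes a :: nat
  defines "P \<equiv> shifted_legendre a :: 'a :: field_char_0 poly"
  defines "P1 \<equiv> P \<circ>\<^sub>p [:1, 1:]"
  defines "Z \<equiv> 2 * ([:0, 1:] * P1) + 2 * ([:0, 1:] * [:2, 1:] * pderiv P1)"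
  shows "of_nat (2 * a + 1) * poly_int (P * Z)
     = 2 * of_nat a ^ 2 + 2 * of_nat a - 1"
proof -
  define X where "X = [:0, 1 :: 'a:]"
  define l where "l = (of_nat (a * (a + 1)) :: 'a poly)"
  define N where "N = poly_int (P * P)"
  define r where "r = P1 - P - pderiv P"
  \<comment> \<open>The part of \<open>Z\<close> of degree below a: r has degree at most a - 2, and
    each derivative compensates one factor v.\<close>
  define low where "low = 2 * ([:0, 1:] * r) + 2 * ([:0, 1:] * ([:2, 1:] * pderiv r))
     + 2 * ([:0, 1:] * pderiv (pderiv P)) - 2 * pderiv P"
  have X2: "[:2, 1:] = X + 2" and X11: "[:0, 1, 1:] = X ^ 2 + X"
    by (simp_all add: X_def numeral_poly power2_eq_square)
  have dX: "pderiv X = 1" by (simp add: X_def pderiv_pCons)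
  have N: "of_nat (2 * a + 1) * N = 1"
    unfolding N_def P_def by (rule poly_int_legendre_square)
  have ode: "(2 * X + 1) * pderiv P + (X ^ 2 + X) * pderiv (pderiv P) = l * P"
    using shifted_legendre_ode[of a, where 'a = 'a]
    by (simp add: X11 pderiv_mult pderiv_add power2_eq_square dX P_def l_def algebra_simps)
  \<comment> \<open>Pure algebra with D and D2 in place of P' and P'': the differential equation
    trades (v^2 + v) P'' for P and P'.\<close>
  have ring: "2 * (X * (P + D + r)) + 2 * (X * (X + 2) * (D + D2 + r'))
      = 2 * (X * P) + 2 * (X * D) + 2 * (X ^ 2 * D) + 2 * (l * P)
        + (2 * (X * r) + 2 * (X * ((X + 2) * r')) + 2 * (X * D2) - 2 * D)"
    if "(2 * X + 1) * D + (X ^ 2 + X) * D2 = l * P" for D D2 r r' :: "'a poly"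
    unfolding that[symmetric] by (simp add: algebra_simps power2_eq_square)
  have "P1 = P + pderiv P + r" "pderiv P1 = pderiv P + pderiv (pderiv P) + pderiv r"
    by (simp_all add: r_def pderiv_diff)
  hence Z: "Z = 2 * (X * P) + 2 * (X * pderiv P) + 2 * (X ^ 2 * pderiv P) + 2 * (l * P) + low"
    using ring[OF ode, of r "pderiv r"] unfolding X2 X_def[symmetric] low_def Z_def by (simp only:)
  have "P * Z = 2 * (X * P * P) + 2 * (X * P * pderiv P) + 2 * (X ^ 2 * P * pderiv P)
      + 2 * (l * (P * P)) + P * low"
    unfolding Z by (simp only: distrib_left mult_ac)
  hence split: "poly_int (P * Z) = 2 * poly_int (X * P * P) + 2 * poly_int (X * P * pderiv P)
        + 2 * poly_int (X ^ 2 * P * pderiv P) + 2 * (of_nat (a * (a + 1)) * N) + poly_int (P * low)"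
    by (simp only: poly_int_linear l_def N_def)
  have "poly_int (P * low) = 0"
    unfolding P_def
  proof (rule shifted_legendre_orthogonal)
    fix k assume k: "a \<le> k"
    have dP: "degree P = a" by (simp add: P_def degree_shifted_legendre)
    have r: "coeff r j = 0" if "a < j + 2" for j
      using coeff_shift_diff[of P j] that by (simp add: r_def P1_def dP)
    have P: "coeff P j = 0" if "a < j" for j
      using that by (simp add: coeff_eq_0 dP)
    show "coeff low k = 0"
      unfolding low_def numeral_poly coeff_add coeff_diff coeff_linear_factor_mult coeff_pderiv
        mult_pCons_left[of "numeral _"] mult_zero_left coeff_smult pCons_0_0 add_0_right
      using k by (simp add: r P coeff_pCons coeff_pderiv split: nat.split)
  qed
  \<comment> \<open>Three integrals remain. The first follows from the symmetry v -> -1 - v, the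
    other two from the boundary values of v P^2 and v^2 P^2.\<close>
  moreover have "2 * poly_int (X * P * P) = - N"
  proof -
    have "P \<circ>\<^sub>p [:- 1, - 1:] = smult ((- 1) ^ a) P"
      unfolding P_def by (rule shifted_legendre_reflect)
    hence "(X * P * P) \<circ>\<^sub>p [:- 1, - 1:] = - (P * P) - X * P * P"
      by (simp add: pcompose_mult X_def pcompose_pCons flip: power_mult_distrib)
    hence "poly_int (X * P * P) = - N - poly_int (X * P * P)"
      using poly_int_reflect[of "X * P * P"] by (simp add: poly_int_linear N_def)
    thus ?thesis by simp
  qed
  moreover have "2 * poly_int (X * P * pderiv P) = 1 - N"
  proof -
    have "pderiv (X * P * P) = P * P + 2 * (X * P * pderiv P)"
      unfolding pderiv_mult dX by (simp add: algebra_simps)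
    hence "N + 2 * poly_int (X * P * pderiv P) = poly (X * P * P) 0 - poly (X * P * P) (- 1)"
      by (metis poly_int_pderiv poly_int_add poly_int_numeral_mult N_def)
    also have "\<dots> = 1"
      by (simp add: X_def P_def flip: power_mult_distrib)
    finally show ?thesis by (simp add: eq_diff_eq add.commute)
  qed
  moreover have "2 * poly_int (X ^ 2 * P * pderiv P) = - 1 - 2 * poly_int (X * P * P)"
  proof -
    have "pderiv (X ^ 2 * P * P) = 2 * (X * P * P) + 2 * (X ^ 2 * P * pderiv P)"
      unfolding power2_eq_square pderiv_mult dX by (simp add: algebra_simps)
    hence "2 * poly_int (X * P * P) + 2 * poly_int (X ^ 2 * P * pderiv P)
        = poly (X ^ 2 * P * P) 0 - poly (X ^ 2 * P * P) (- 1)"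
      by (metis poly_int_pderiv poly_int_add poly_int_numeral_mult)
    also have "\<dots> = - 1"
      by (simp add: X_def P_def flip: power_mult_distrib)
    finally show ?thesis by (simp add: eq_diff_eq add.commute)
  qed
  ultimately have "poly_int (P * Z) = 2 * of_nat (a * (a + 1)) * N - N"
    unfolding split by simp
  hence "of_nat (2 * a + 1) * poly_int (P * Z)
      = (2 * of_nat (a * (a + 1)) - 1) * (of_nat (2 * a + 1) * N)"
    by (simp only: left_diff_distrib right_diff_distrib mult_ac mult_1_left)
  thus ?thesis unfolding N by (simp add: algebra_simps power2_eq_square)
qed

text \<open>Up to the sign (-1)^a the integrand at w is half of h(2w), where h(v) = (v + 2) (v P)'
  P(v + 1). Folding [-2, 0] at -1 then brings everything to [-1, 0].\<close>

lemma poly_int_legendre_pairing: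
  fixes a :: nat
  defines "P \<equiv> shifted_legendre a :: 'a :: field_char_0 poly"
  shows "poly_int ([:1, 1:] * pderiv ([:0, 1:] * (P \<circ>\<^sub>p [:0, 2:])) * smult ((- 1) ^ a) (P \<circ>\<^sub>p [:1, 2:]))
    = 1 / 4 - (- 1) ^ a * (2 * of_nat a ^ 2 + 2 * of_nat a - 1) / (4 * of_nat (2 * a + 1))"
proof -
  define X where "X = [:0, 1 :: 'a:]"
  define e where "e = (- 1 :: 'a) ^ a"
  define Q u where "Q = (2 * of_nat a ^ 2 + 2 * of_nat a - 1 :: 'a)" and "u = (of_nat (2 * a + 1) :: 'a)"
  define P1 where "P1 = P \<circ>\<^sub>p [:1, 1:]"
  define h where "h = [:2, 1:] * pderiv (X * P) * P1"
  define f where "f = [:1, 1:] * pderiv ([:0, 1:] * (P \<circ>\<^sub>p [:0, 2:])) * (P \<circ>\<^sub>p [:1, 2:])"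
  define Z where "Z = 2 * ([:0, 1:] * P1) + 2 * ([:0, 1:] * [:2, 1:] * pderiv P1)"
  have ee: "e * e = 1" by (simp add: e_def flip: power_mult_distrib)
  have dX: "pderiv X = 1" by (simp add: X_def pderiv_pCons)
  have X2: "[:2, 1:] = X + 2"
    by (simp add: X_def numeral_poly)
  have refl: "P \<circ>\<^sub>p [:- 1, - 1:] = smult e P"
    unfolding P_def e_def by (rule shifted_legendre_reflect)
  have "h \<circ>\<^sub>p [:0, 2:] = smult 2 f"
  proof -
    have "P1 \<circ>\<^sub>p [:0, 2:] = P \<circ>\<^sub>p [:1, 2:]"
      by (simp add: P1_def pcompose_pCons flip: pcompose_assoc)
    moreover have "pderiv (X * P) \<circ>\<^sub>p [:0, 2:] = pderiv ([:0, 1:] * (P \<circ>\<^sub>p [:0, 2:]))"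
      unfolding pderiv_mult dX pcompose_add pcompose_mult pderiv_pcompose
      by (simp add: X_def pderiv_pCons pcompose_pCons)
    moreover have "[:2, 1:] \<circ>\<^sub>p [:0, 2:] = smult 2 [:1, 1 :: 'a:]"
      by (simp add: pcompose_pCons)
    ultimately show ?thesis
      by (simp only: h_def f_def pcompose_mult mult_smult_left)
  qed
  hence f: "4 * poly_int f = poly_int h + poly_int (h \<circ>\<^sub>p [:- 2, - 1:])"
    using poly_int_double[of h] by simp
  have h': "h \<circ>\<^sub>p [:- 2, - 1:] = - (X * (P1 + [:2, 1:] * pderiv P1) * P)"
  proof -
    have P: "P \<circ>\<^sub>p [:- 2, - 1:] = smult e P1"
      using arg_cong[OF refl, of "\<lambda>p. p \<circ>\<^sub>p [:1, 1:]"]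
      by (simp add: P1_def pcompose_pCons pcompose_smult flip: pcompose_assoc)
    have dP: "pderiv P \<circ>\<^sub>p [:- 2, - 1:] = - smult e (pderiv P1)"
      using arg_cong[OF P, of pderiv]
      by (simp add: pderiv_pcompose pderiv_pCons pderiv_smult minus_equation_iff)
    have "P1 \<circ>\<^sub>p [:- 2, - 1:] = smult e P"
      unfolding refl[symmetric] by (simp add: P1_def pcompose_pCons flip: pcompose_assoc)
    moreover have "pderiv (X * P) \<circ>\<^sub>p [:- 2, - 1:] = smult e (P1 + [:2, 1:] * pderiv P1)"
      unfolding pderiv_mult dX pcompose_add pcompose_mult P dP
      by (simp add: X_def pcompose_pCons smult_add_right smult_diff_right)
    moreover have "[:2, 1:] \<circ>\<^sub>p [:- 2, - 1:] = - X"
      by (simp add: X_def pcompose_pCons)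
    ultimately have "h \<circ>\<^sub>p [:- 2, - 1:] = - X * smult e (P1 + [:2, 1:] * pderiv P1) * smult e P"
      by (simp only: h_def pcompose_mult)
    thus ?thesis by (simp only: mult_smult_left mult_smult_right smult_smult ee) simp
  qed
  \<comment> \<open>Subtracting an exact derivative removes the term with P', so that
    \<open>P\<close> appears undifferentiated as a factor and orthogonality can be used.\<close>
  have "h + h \<circ>\<^sub>p [:- 2, - 1:] = pderiv (X * [:2, 1:] * (P * P1)) - P * Z"
    unfolding h' unfolding h_def Z_def X_def[symmetric] X2 pderiv_mult pderiv_add dX
    by (simp add: algebra_simps)
  hence "poly_int h + poly_int (h \<circ>\<^sub>p [:- 2, - 1:])
      = poly (X * [:2, 1:] * (P * P1)) 0 - poly (X * [:2, 1:] * (P * P1)) (- 1) - poly_int (P * Z)"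
    by (metis poly_int_add poly_int_diff poly_int_pderiv)
  also have "poly (X * [:2, 1:] * (P * P1)) 0 - poly (X * [:2, 1:] * (P * P1)) (- 1) = e"
    by (simp add: X_def P_def P1_def e_def poly_pcompose)
  also have "poly_int (P * Z) = Q / u"
    using poly_int_legendre_shift[of a, where 'a = 'a] of_nat_neq_0[of "2 * a", where 'a = 'a]
    unfolding Z_def P1_def P_def Q_def u_def by (simp add: nonzero_eq_divide_eq mult.commute)
  finally have "4 * poly_int f = e - Q / u" unfolding f .
  hence "poly_int f = (e - Q / u) / 4"
    by (metis nonzero_mult_div_cancel_left zero_neq_numeral)
  hence "e * poly_int f = 1 / 4 - e * Q / (4 * u)"
    using ee by (simp add: right_diff_distrib diff_divide_distrib mult.commute)
  thus ?thesis unfolding f_def e_def Q_def u_def by simp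
qed

section \<open>Binomial expansions\<close>

abbreviation newton_eval :: "'a :: comm_ring_1 poly \<Rightarrow> nat \<Rightarrow> 'a" where
  "newton_eval p n \<equiv> coeff_pairing (\<lambda>k. of_nat (n choose k)) p"

text \<open>The factor \<open>(- 1) ^ k * of_nat (n + k choose k)\<close> is the binomial coefficient \<open>(-1 - n) gchoose k\<close>.\<close>

abbreviation rising_eval :: "'a :: comm_ring_1 poly \<Rightarrow> nat \<Rightarrow> 'a" where
  "rising_eval p n \<equiv> coeff_pairing (\<lambda>k. (- 1) ^ k * of_nat (n + k choose k)) p"

text \<open>Pascal's rule: lowering the argument by one multiplies the generating polynomial by 1 +
  w. The next lemma is the same rule with upper index -1 - n.\<close>

lemma newton_eval_pCons_Suc:
  "newton_eval (pCons 0 q) (Suc n) = newton_eval (q + pCons 0 q) n"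
  unfolding coeff_pairing_add coeff_pairing_pCons
  by (simp add: coeff_pairing_def sum.distrib distrib_left)

lemma rising_eval_pCons_Suc:
  "rising_eval (q + pCons 0 q) (Suc n) = rising_eval (pCons 0 q) n"
  unfolding coeff_pairing_add coeff_pairing_pCons
  by (simp add: coeff_pairing_def sum.distrib[symmetric] distrib_left algebra_simps)

lemma rising_eval_0: "rising_eval q 0 = poly q (- 1)"
  by (simp add: coeff_pairing_def poly_altdef)

lemma newton_eval_0: "newton_eval q 0 = poly q 0"
  by (cases q) (simp add: coeff_pairing_pCons, simp add: coeff_pairing_def)

text \<open>On powers of w this is Vandermonde's identity followed by negation of the upper index.
  The induction on n needs only Pascal's rule, once the constant term is split off.\<close>

lemma rising_eval_reflect:
  "rising_eval (q \<circ>\<^sub>p [:- 1, - 1:]) n = newton_eval (q :: 'a :: idom poly) n"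
proof (induction n arbitrary: q)
  case 0
  show ?case unfolding rising_eval_0 newton_eval_0 by (simp add: poly_pcompose)
next
  case (Suc n)
  obtain c r where q: "q = pCons c r" by (cases q)
  let ?r = "r \<circ>\<^sub>p [:- 1, - 1:]"
  have const: "coeff_pairing u [:c:] = c * u 0" for u :: "nat \<Rightarrow> 'a"
    by (simp add: coeff_pairing_pCons)
  have "rising_eval (q \<circ>\<^sub>p [:- 1, - 1:]) (Suc n) = c - rising_eval (?r + pCons 0 ?r) (Suc n)"
  proof -
    have "q \<circ>\<^sub>p [:- 1, - 1:] = [:c:] + smult (- 1) (?r + pCons 0 ?r)"
      by (simp add: q pcompose_pCons)
    thus ?thesis by (simp only: coeff_pairing_add[of _ "[:c:]"] coeff_pairing_smult const) simp
  qed
  also have "\<dots> = c - rising_eval (pCons 0 ?r) n"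
    unfolding rising_eval_pCons_Suc ..
  also have "\<dots> = c + rising_eval ((r + pCons 0 r) \<circ>\<^sub>p [:- 1, - 1:]) n"
  proof -
    have "(r + pCons 0 r) \<circ>\<^sub>p [:- 1, - 1:] = smult (- 1) (pCons 0 ?r)"
      by (simp add: pcompose_add pcompose_pCons)
    thus ?thesis by (simp only: coeff_pairing_smult) simp
  qed
  also have "\<dots> = c + newton_eval (r + pCons 0 r) n"
    unfolding Suc.IH ..
  also have "\<dots> = c + newton_eval (pCons 0 r) (Suc n)"
    unfolding newton_eval_pCons_Suc ..
  also have "\<dots> = newton_eval q (Suc n)"
    by (simp add: q coeff_pairing_pCons)
  finally show ?case .
qed

text \<open>Absorption: (n + 1) (n choose k) = (k + 1) ((n choose k) + (n choose k + 1)). The factor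
  k + 1 comes from q -> (w q)', the sum of two binomials from 1 + w.\<close>

lemma newton_eval_mult_Suc:
  fixes q :: "'a :: idom poly"
  shows "newton_eval ([:1, 1:] * pderiv ([:0, 1:] * q)) n = of_nat (n + 1) * newton_eval q n"
proof -
  have 1: "coeff_pairing u ([:1, 1:] * p) = coeff_pairing (\<lambda>k. u k + u (Suc k)) p" for u and p :: "'a poly"
    by (simp add: coeff_pairing_add coeff_pairing_pCons)
      (simp add: coeff_pairing_def sum.distrib distrib_left)
  have deg: "degree (pderiv (pCons 0 q)) \<le> degree q"
    by (rule degree_le) (auto simp: coeff_pderiv coeff_eq_0)
  have 2: "coeff_pairing u (pderiv ([:0, 1:] * q)) = coeff_pairing (\<lambda>k. of_nat (Suc k) * u k) q" for u
    by (subst (1 2) coeff_pairing_altdef[of _ "degree q"])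
      (use deg in \<open>simp_all add: coeff_pderiv mult_ac del: of_nat_Suc\<close>)
  have "of_nat (Suc k) * (of_nat (n choose k) + of_nat (n choose Suc k)) = of_nat (n + 1) * (of_nat (n choose k) :: 'a)" for k
    using arg_cong[OF Suc_times_binomial_eq[of n k], of "of_nat :: nat \<Rightarrow> 'a"]
    by (simp add: algebra_simps)
  thus ?thesis
    unfolding 1 2 by (simp add: coeff_pairing_def sum_distrib_left mult.left_commute)
qed

lemma sum_binomial_product:
  "(k + l + 1) * (\<Sum>n<N. (n choose k) * (n + l choose l)) = N * (N - 1 choose k) * (N + l choose l)"
proof -
  \<comment> \<open>Absorption rewrites the right side without the predecessor N - 1, which makes it
    suitable for induction.\<close>
  have "(k + l + 1) * (\<Sum>n<N. (n choose k) * (n + l choose l)) = (N - k) * (N choose k) * (N + l choose l)"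
  proof (induction N)
    case (Suc N)
    have 1: "(Suc N - k) * (Suc N choose k) = Suc N * (N choose k)"
      using binomial_absorb_comp[of "Suc N" k] by simp
    have 2: "Suc N * (Suc N + l choose l) = (N + l + 1) * (N + l choose l)"
      using binomial_absorb_comp[of "Suc N + l" l] by simp
    have 3: "((N - k) + (k + l + 1)) * (N choose k) = (N + l + 1) * (N choose k)"
      by (cases "k \<le> N") (simp_all add: binomial_eq_0)
    have "(k + l + 1) * (\<Sum>n<Suc N. (n choose k) * (n + l choose l))
        = (((N - k) + (k + l + 1)) * (N choose k)) * (N + l choose l)"
      unfolding sum.lessThan_Suc distrib_left Suc.IH by (simp only: distrib_right distrib_left mult_ac)
    also have "\<dots> = (Suc N * (Suc N + l choose l)) * (N choose k)"
      unfolding 3 2 by (simp only: mult_ac)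
    also have "\<dots> = (Suc N - k) * (Suc N choose k) * (Suc N + l choose l)"
      unfolding 1 by (simp only: mult_ac)
    finally show ?case .
  qed simp
  thus ?thesis unfolding binomial_absorb_comp .
qed

text \<open>The value t_n(a) at a natural number a; \<open>dual_sum_altdef\<close> gives the
  explicit sum.\<close>

definition dual_sum :: "nat \<Rightarrow> nat \<Rightarrow> 'a :: field_char_0" where
  "dual_sum a n = newton_eval (shifted_legendre a \<circ>\<^sub>p [:0, 2:]) n"

text \<open>The polynomials \<open>f\<close> and \<open>g\<close> of the introduction.\<close>

definition legendre_left :: "nat \<Rightarrow> 'a :: field_char_0 poly" where
  "legendre_left a = [:1, 1:] * pderiv ([:0, 1:] * (shifted_legendre a \<circ>\<^sub>p [:0, 2:]))"

definition legendre_right :: "nat \<Rightarrow> 'a :: field_char_0 poly" where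
  "legendre_right a = smult ((- 1) ^ a) (shifted_legendre a \<circ>\<^sub>p [:1, 2:])"

lemma dual_sum_left: "newton_eval (legendre_left a) n = of_nat (n + 1) * dual_sum a n"
  unfolding legendre_left_def dual_sum_def newton_eval_mult_Suc ..

text \<open>Reflecting w in P(2w) gives P(-2 - 2w), which is (-1)^a P(2w + 1).\<close>

lemma dual_sum_right: "rising_eval (legendre_right a) n = (dual_sum a n :: 'a :: field_char_0)"
proof -
  have "legendre_right a = (shifted_legendre a \<circ>\<^sub>p [:0, 2:]) \<circ>\<^sub>p [:- 1, - 1 :: 'a:]"
    using arg_cong[OF shifted_legendre_reflect[of a, where 'a = 'a], of "\<lambda>p. p \<circ>\<^sub>p [:1, 2:]"]
    by (simp add: legendre_right_def pcompose_smult pcompose_pCons flip: pcompose_assoc)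
  thus ?thesis by (simp only: rising_eval_reflect dual_sum_def)
qed

text \<open>One factor is expanded in n choose k and the other in -1 - n choose l, since for these
  products the sum over n has the closed form \<open>sum_binomial_product\<close>.\<close>

lemma sum_dual_sum_square:
  "(\<Sum>n<N. of_nat (n + 1) * dual_sum a n ^ 2)
     = (\<Sum>k\<le>degree (legendre_left a :: 'a poly). \<Sum>l\<le>degree (legendre_right a :: 'a poly).
          coeff (legendre_left a) k * coeff (legendre_right a) l
            * ((- 1) ^ l * of_nat (\<Sum>n<N. (n choose k) * (n + l choose l))) :: 'a :: field_char_0)"
proof -
  have "(\<Sum>n<N. of_nat (n + 1) * dual_sum a n ^ 2)
      = (\<Sum>n<N. newton_eval (legendre_left a) n * (rising_eval (legendre_right a) n :: 'a))"
    unfolding dual_sum_left dual_sum_right by (simp add: power2_eq_square mult_ac)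
  also have "\<dots> = (\<Sum>n<N. \<Sum>k\<le>degree (legendre_left a :: 'a poly). \<Sum>l\<le>degree (legendre_right a :: 'a poly).
      coeff (legendre_left a) k * coeff (legendre_right a) l
            * ((- 1) ^ l * of_nat ((n choose k) * (n + l choose l))))"
    by (simp add: coeff_pairing_def sum_product mult_ac)
  also have "\<dots> = (\<Sum>k\<le>degree (legendre_left a :: 'a poly). \<Sum>l\<le>degree (legendre_right a :: 'a poly).
      \<Sum>n<N. coeff (legendre_left a) k * coeff (legendre_right a) l
            * ((- 1) ^ l * of_nat ((n choose k) * (n + l choose l))))"
    by (subst sum.swap, intro sum.cong refl sum.swap)
  finally show ?thesis by (simp only: of_nat_sum sum_distrib_left)
qed

lemma poly_int_left_right:
  "poly_int (legendre_left a * legendre_right a)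
     = 1 / 4 - (- 1) ^ a * (2 * of_nat a ^ 2 + 2 * of_nat a - 1) / (4 * of_nat (2 * a + 1))"
  unfolding legendre_left_def legendre_right_def by (rule poly_int_legendre_pairing)

lemma coeff_legendre_left:
  "coeff (legendre_left a) k = of_nat (Suc k) * 2 ^ k * coeff (shifted_legendre a) k
     + (if k = 0 then 0 else of_nat k * 2 ^ (k - 1) * coeff (shifted_legendre a) (k - 1))"
  by (cases k) (simp_all add: legendre_left_def coeff_pderiv coeff_pcompose_linear coeff_shifted_legendre)

lemma coeff_legendre_left_in_Ints: "coeff (legendre_left a) k \<in> \<int>"
  unfolding coeff_legendre_left coeff_shifted_legendre by (auto simp del: of_nat_Suc)

lemma coeff_legendre_right_in_Ints: "coeff (legendre_right a :: 'a :: field_char_0 poly) k \<in> \<int>"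
proof -
  have "coeff (shifted_legendre a \<circ>\<^sub>p [:1, 2 :: 'a:]) k \<in> \<int>"
    by (rule coeff_pcompose_semiring_closed) (auto simp: coeff_shifted_legendre coeff_pCons split: nat.split)
  thus ?thesis by (simp add: legendre_right_def)
qed

lemma degree_legendre_left: "degree (legendre_left a) \<le> a + 1"
  by (rule degree_le) (auto simp: coeff_legendre_left coeff_shifted_legendre binomial_eq_0)

lemma degree_legendre_right: "degree (legendre_right a) \<le> a"
  unfolding legendre_right_def using degree_pcompose_le[of "shifted_legendre a" "[:1, 2 :: 'a:]"]
  by (simp add: degree_shifted_legendre)

lemma dual_sum_altdef:
  "dual_sum a n = (\<Sum>k\<le>n. of_nat ((n choose k) * (a choose k) * (a + k choose k)) * 2 ^ k)"
proof -
  have "dual_sum a n = (\<Sum>k\<le>max a n. of_nat ((n choose k) * (a choose k) * (a + k choose k)) * 2 ^ k)"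
    unfolding dual_sum_def
    by (subst coeff_pairing_altdef[of _ "max a n"])
      (simp_all add: degree_pcompose degree_shifted_legendre coeff_pcompose_linear
        coeff_shifted_legendre mult_ac)
  also have "\<dots> = (\<Sum>k\<le>n. of_nat ((n choose k) * (a choose k) * (a + k choose k)) * 2 ^ k)"
    by (intro sum.mono_neutral_right) auto
  finally show ?thesis .
qed

section \<open>Binomial coefficients modulo a prime and its square\<close>

lemma binomial_pred_prime_cong:
  assumes "prime p" "k < p"
  shows "[int (p - 1 choose k) = (- 1) ^ k] (mod int p)"
  using \<open>k < p\<close>
proof (induction k)
  case (Suc k)
  have "p = Suc (p - 1)" using \<open>prime p\<close> by (simp add: prime_gt_0_nat)
  hence "(p choose Suc k) = (p - 1 choose k) + (p - 1 choose Suc k)"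
    by (metis binomial_Suc_Suc)
  moreover have "p dvd (p choose Suc k)"
    using assms Suc.prems by (intro dvd_choose_prime) auto
  ultimately have "[int (p - 1 choose k) + int (p - 1 choose Suc k) = 0] (mod int p)"
    by (metis cong_0_iff of_nat_add of_nat_dvd_iff)
  from cong_diff[OF this Suc.IH] Suc.prems show ?case by simp
qed simp

lemma cong_mult_lcancel_prime_power:
  assumes "prime p" "0 < m" "m < p" "[int m ^ i * a = int m ^ i * b] (mod int p ^ j)"
  shows "[a = b] (mod int p ^ j)"
proof -
  have "coprime m p"
    using assms by (metis coprime_commute prime_imp_coprime nat_dvd_not_less)
  thus ?thesis using assms(4) by (simp add: cong_mult_lcancel)
qed

lemma binomial_prime_add_cong:
  assumes "prime p" "l < p"
  shows "[int (p + l choose l) = 1] (mod int p)"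
  using \<open>l < p\<close>
proof (induction l)
  case (Suc l)
  have "Suc l * (p + Suc l choose Suc l) = (p + Suc l) * (p + l choose l)"
    using Suc_times_binomial_eq[of "p + l" l] by simp
  hence "int (Suc l) * int (p + Suc l choose Suc l) = int (p + Suc l) * int (p + l choose l)"
    by (metis of_nat_mult)
  moreover have "[int (p + Suc l) * int (p + l choose l) = int (Suc l) * 1] (mod int p)"
    using Suc by (intro cong_mult) (auto simp: cong_iff_dvd_diff)
  ultimately have "[int (Suc l) ^ 1 * int (p + Suc l choose Suc l) = int (Suc l) ^ 1 * 1] (mod int p ^ 1)"
    by simp
  thus ?case using cong_mult_lcancel_prime_power[OF \<open>prime p\<close> _ Suc.prems] by fastforce
qed simp

text \<open>The ratio of consecutive values is (p^2 - (l + 1)^2) / (l + 1)^2, which is -1 modulo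
  p^2. This extra precision serves the terms in which a denominator p occurs.\<close>

lemma binomial_product_cong_square:
  assumes "prime p" "l < p"
  shows "[int ((p - 1 choose l) * (p + l choose l)) = (- 1) ^ l] (mod int p ^ 2)"
  using \<open>l < p\<close>
proof (induction l)
  case (Suc l)
  let ?u = "\<lambda>l. int ((p - 1 choose l) * (p + l choose l))"
  have 1: "Suc l * (p + Suc l choose Suc l) = (p + Suc l) * (p + l choose l)"
    using Suc_times_binomial_eq[of "p + l" l] by simp
  have 2: "Suc l * (p - 1 choose Suc l) = (p - 1 - l) * (p - 1 choose l)"
    by (metis binomial_absorb_comp binomial_absorption)
  have "Suc l ^ 2 * ((p - 1 choose Suc l) * (p + Suc l choose Suc l))
     = (Suc l * (p - 1 choose Suc l)) * (Suc l * (p + Suc l choose Suc l))"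
    by (simp only: power2_eq_square mult_ac)
  also have "\<dots> = (p - 1 - l) * (p + Suc l) * ((p - 1 choose l) * (p + l choose l))"
    unfolding 1 2 by (simp only: mult_ac)
  finally have "int (Suc l) ^ 2 * ?u (Suc l) = int (p - 1 - l) * int (p + Suc l) * ?u l"
    by (metis of_nat_mult of_nat_power)
  also have "int (p - 1 - l) * int (p + Suc l) = int p ^ 2 - int (Suc l) ^ 2"
    using Suc.prems by (simp add: of_nat_diff algebra_simps power2_eq_square)
  also have "[(int p ^ 2 - int (Suc l) ^ 2) * ?u l = (0 - int (Suc l) ^ 2) * (- 1) ^ l] (mod int p ^ 2)"
    using Suc by (intro cong_mult cong_diff) (auto simp: cong_def)
  finally have "[int (Suc l) ^ 2 * ?u (Suc l) = int (Suc l) ^ 2 * (- 1) ^ Suc l] (mod int p ^ 2)"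
    by simp
  thus ?case using cong_mult_lcancel_prime_power[OF \<open>prime p\<close> _ Suc.prems] by blast
qed simp

lemma prime_dvd_central_binomial:
  assumes "prime p"
  shows "p dvd (2 * (p - 1) choose (p - 1))"
proof -
  have p: "p \<ge> 2" using assms by (rule prime_ge_2_nat)
  have "(p - 1) * (2 * (p - 1) choose (p - 1)) = p * (2 * (p - 1) choose (p - 2))"
    using p binomial_absorption[of "p - 2" "2 * (p - 1)"] binomial_absorb_comp[of "2 * (p - 1)" "p - 2"]
    by (auto simp: Suc_diff_Suc numeral_2_eq_2)
  hence "p dvd (p - 1) * (2 * (p - 1) choose (p - 1))" by simp
  moreover have "\<not> p dvd p - 1" using p by (simp add: nat_dvd_not_less)
  ultimately show ?thesis using assms by (simp add: prime_dvd_mult_iff)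
qed

section \<open>Ideals of the p-adic integers\<close>

text \<open>The ideal generated by p^j, placed inside the field. For j = 0 it is the ring of p-adic
  integers, so integrality and divisibility obey the same rules.\<close>

definition padic_ideal :: "nat \<Rightarrow> 'p :: prime_card padic set" where
  "padic_ideal j = range (\<lambda>z. of_nat CARD('p) ^ j * to_fract z)"

lemma padic_idealI: "x = of_nat CARD('p) ^ j * to_fract z \<Longrightarrow> x \<in> padic_ideal j"
  for x :: "'p :: prime_card padic"
  by (auto simp: padic_ideal_def)

lemma padic_cong_iff_ideal:
  fixes a b :: "'p :: prime_card padic"
  shows "padic_cong a b (CARD('p) ^ j) \<longleftrightarrow> a - b \<in> padic_ideal j"
  by (auto simp: padic_cong_def padic_ideal_def)

lemma to_fract_in_ideal [simp]: "to_fract z \<in> padic_ideal 0"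
  by (rule padic_idealI[of _ _ z]) simp

lemma padic_ideal_add: "x \<in> padic_ideal j \<Longrightarrow> y \<in> padic_ideal j \<Longrightarrow> x + y \<in> padic_ideal j"
  by (auto simp: padic_ideal_def intro!: image_eqI[of _ _ "_ + _"] simp flip: distrib_left to_fract_add)

lemma padic_ideal_mult: "x \<in> padic_ideal i \<Longrightarrow> y \<in> padic_ideal j \<Longrightarrow> x * y \<in> padic_ideal (i + j)"
  by (auto simp: padic_ideal_def power_add mult_ac intro!: image_eqI[of _ _ "_ * _"])

lemma padic_ideal_mult_left: "x \<in> padic_ideal 0 \<Longrightarrow> y \<in> padic_ideal j \<Longrightarrow> x * y \<in> padic_ideal j"
  using padic_ideal_mult[of x 0 y j] by simp

lemma padic_ideal_mult_right: "x \<in> padic_ideal j \<Longrightarrow> y \<in> padic_ideal 0 \<Longrightarrow> x * y \<in> padic_ideal j"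
  using padic_ideal_mult[of x j y 0] by simp

lemma of_int_in_ideal_0 [simp]: "of_int n \<in> padic_ideal 0"
proof -
  have "to_fract (of_int n :: 'a padic_int) = of_int n"
    by (cases n rule: int_cases2) (simp_all add: to_fract_of_nat)
  thus ?thesis by (metis to_fract_in_ideal)
qed

lemma of_nat_in_ideal_0 [simp]: "of_nat n \<in> padic_ideal 0"
  using of_int_in_ideal_0[of "int n"] by simp

lemma padic_ideal_0_simps [simp]:
  "0 \<in> padic_ideal 0" "1 \<in> padic_ideal 0" "numeral m \<in> padic_ideal 0" "- 1 \<in> padic_ideal 0"
  using of_int_in_ideal_0[of 0] of_int_in_ideal_0[of 1] of_int_in_ideal_0[of "numeral m"]
    of_int_in_ideal_0[of "- 1"] by simp_all

lemma padic_ideal_0 [simp]: "0 \<in> padic_ideal j"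
  by (rule padic_idealI[of _ _ 0]) simp

lemma padic_ideal_minus: "x \<in> padic_ideal j \<Longrightarrow> - x \<in> padic_ideal j"
  using padic_ideal_mult_left[of "- 1" x j] by simp

lemma padic_ideal_diff: "x \<in> padic_ideal j \<Longrightarrow> y \<in> padic_ideal j \<Longrightarrow> x - y \<in> padic_ideal j"
  using padic_ideal_add[of x j "- y"] padic_ideal_minus[of y j] by simp

lemma padic_ideal_diff_trans:
  "u - v \<in> padic_ideal j \<Longrightarrow> v - w \<in> padic_ideal j \<Longrightarrow> u - w \<in> padic_ideal j"
  using padic_ideal_add[of "u - v" j "v - w"] by simp

lemma padic_ideal_sum: "(\<And>i. i \<in> A \<Longrightarrow> f i \<in> padic_ideal j) \<Longrightarrow> sum f A \<in> padic_ideal j"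
  by (induction A rule: infinite_finite_induct) (simp_all add: padic_ideal_add)

lemma padic_ideal_power: "x \<in> padic_ideal 0 \<Longrightarrow> x ^ n \<in> padic_ideal 0"
  by (induction n) (simp_all add: padic_ideal_mult_left)

lemma padic_ideal_Suc_subset:
  fixes x :: "'p :: prime_card padic"
  assumes "x \<in> padic_ideal (Suc j)"
  shows "x \<in> padic_ideal j"
proof -
  obtain z where "x = of_nat CARD('p) ^ j * (of_nat CARD('p) * to_fract z)"
    using assms by (auto simp: padic_ideal_def mult_ac)
  thus ?thesis by (intro padic_idealI[of _ _ "of_nat CARD('p) * z"]) (simp add: to_fract_of_nat)
qed

lemma of_nat_card_in_ideal [simp]: "(of_nat CARD('p) :: 'p :: prime_card padic) \<in> padic_ideal 1"
  by (rule padic_idealI[of _ _ 1]) simp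

lemma of_int_in_ideal:
  assumes "int CARD('p) ^ j dvd n"
  shows "(of_int n :: 'p :: prime_card padic) \<in> padic_ideal j"
proof -
  obtain m where "n = int CARD('p) ^ j * m" using assms by blast
  moreover have "of_nat CARD('p) ^ j \<in> (padic_ideal j :: 'p padic set)"
    by (rule padic_idealI[of _ _ 1]) simp
  ultimately show ?thesis by (simp add: padic_ideal_mult_right)
qed

text \<open>Inverses exist modulo every p^n; reduced modulo p^n they are unique, hence compatible,
  and define a p-adic integer.\<close>

lemma padic_unit_exists_inverse:
  fixes z :: "'p :: prime_card padic_int"
  assumes "padic_residue z 1 \<noteq> 0"
  shows "\<exists>w. z * w = 1"
proof -
  let ?p = "int CARD('p)"
  have prime: "prime ?p" by (rule prime_card_int)
  have cop: "coprime (padic_residue z n) (?p ^ m)" if "n \<noteq> 0" for n m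
  proof -
    have "\<not> ?p dvd padic_residue z n"
      using assms padic_residue_mod[of 1 n z] that by (auto simp: dvd_eq_mod_eq_0)
    hence "coprime ?p (padic_residue z n)" using prime by (rule prime_imp_coprime[rotated])
    thus ?thesis by (simp add: coprime_commute)
  qed
  have "\<exists>x. [padic_residue z n * x = 1] (mod ?p ^ n)" for n
    using cong_solve_coprime_int[OF cop[of n n]] by (cases "n = 0") auto
  then obtain y where y: "\<And>n. [padic_residue z n * y n = 1] (mod ?p ^ n)" by metis
  define f where "f n = y n mod ?p ^ n" for n
  have f: "[padic_residue z n * f n = 1] (mod ?p ^ n)" for n
    using y[of n] by (simp add: f_def cong_def mod_mult_right_eq)
  have "f (Suc n) mod ?p ^ n = f n" for n
  proof (cases "n = 0")
    case False
    have "[padic_residue z (Suc n) * f (Suc n) = 1] (mod ?p ^ n)"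
      using f[of "Suc n"] by (rule cong_dvd_modulus) (simp add: le_imp_power_dvd)
    moreover have "[padic_residue z (Suc n) = padic_residue z n] (mod ?p ^ n)"
      using padic_residue_mod[of n "Suc n" z] padic_residue_mod[of n n z] by (simp add: cong_def)
    ultimately have "[padic_residue z n * f (Suc n) = padic_residue z n * f n] (mod ?p ^ n)"
      using f[of n] by (metis cong_scalar_right cong_sym cong_trans)
    hence "[f (Suc n) = f n] (mod ?p ^ n)"
      using cop[OF False, of n] by (simp add: cong_mult_lcancel)
    thus ?thesis by (simp add: cong_def f_def)
  qed (simp add: f_def)
  moreover have "f n \<in> {0..<?p ^ n}" for n
    by (simp add: f_def)
  ultimately have "f \<in> {x. \<forall>n. x n \<in> {0..<?p ^ n} \<and> x (Suc n) mod ?p ^ n = x n}"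
    by blast
  hence rep: "padic_residue (Abs_padic_int f :: 'p padic_int) = f"
    by (rule Abs_padic_int_inverse)
  have "padic_residue (z * Abs_padic_int f) n = padic_residue (1 :: 'p padic_int) n" for n
    using f[of n] by (simp add: times_padic_int.rep_eq one_padic_int.rep_eq rep cong_def)
  thus ?thesis by (metis padic_residue_inject ext)
qed

lemma inverse_in_padic_ideal:
  fixes x :: "'p :: prime_card padic"
  assumes "x \<in> padic_ideal 0" "x \<notin> padic_ideal 1"
  shows "inverse x \<in> padic_ideal 0"
proof -
  obtain z where z: "x = to_fract z" using assms(1) by (auto simp: padic_ideal_def)
  have "padic_residue z 1 \<noteq> 0"
    using assms(2) unfolding padic_residue_1_eq_0_iff z
    by (metis padic_idealI power_one_right to_fract_mult to_fract_of_nat)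
  then obtain w where "z * w = 1" using padic_unit_exists_inverse by blast
  hence "x * to_fract w = 1" by (simp add: z flip: to_fract_mult)
  hence "inverse x = to_fract w" by (rule inverse_unique)
  thus ?thesis by simp
qed

lemma of_nat_in_ideal_1_iff:
  "(of_nat n :: 'p :: prime_card padic) \<in> padic_ideal 1 \<longleftrightarrow> CARD('p) dvd n"
proof
  assume "(of_nat n :: 'p padic) \<in> padic_ideal 1"
  then obtain z where "(of_nat n :: 'p padic) = of_nat CARD('p) * to_fract z"
    by (auto simp: padic_ideal_def)
  hence "(of_nat n :: 'p padic_int) = of_nat CARD('p) * z"
    by (metis to_fract_eq_iff to_fract_mult to_fract_of_nat)
  hence "padic_residue (of_nat n :: 'p padic_int) 1 = 0"
    unfolding padic_residue_1_eq_0_iff by blast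
  thus "CARD('p) dvd n"
    by (simp add: padic_residue_of_nat dvd_eq_mod_eq_0 flip: of_nat_mod)
next
  assume "CARD('p) dvd n"
  thus "(of_nat n :: 'p padic) \<in> padic_ideal 1"
    using of_int_in_ideal[of 1 "int n", where 'p = 'p] by simp
qed

lemma inverse_of_nat_in_ideal:
  "\<not> CARD('p) dvd n \<Longrightarrow> inverse (of_nat n :: 'p :: prime_card padic) \<in> padic_ideal 0"
  by (rule inverse_in_padic_ideal) (simp_all only: of_nat_in_ideal_1_iff of_nat_in_ideal_0 simp_thms)

lemma Ints_subset_padic_ideal: "x \<in> \<int> \<Longrightarrow> x \<in> padic_ideal 0"
  by (auto elim: Ints_cases)

section \<open>Congruences modulo the square of p\<close>

text \<open>The error is p (b - (-1)^k) / m with m = k + l + 1. If k < p and p does not divide m,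
  then b is (-1)^k modulo p; if k < p and m = p, the congruence modulo p^2 makes up for the
  denominator. If k = p, the quotient p / m is integral because m = 2p is the only multiple of p
  possible, and \<open>F\<close> supplies p^2.\<close>

lemma binomial_term_cong:
  fixes F G :: "'p :: prime_card padic"
  defines "p \<equiv> CARD('p)"
  assumes odd: "odd p" and kl: "k \<le> p" "l < p"
    and F: "F \<in> padic_ideal 0" "k = p \<Longrightarrow> F \<in> padic_ideal 2" and G: "G \<in> padic_ideal 0"
  shows "F * G * ((- 1) ^ l * of_nat (\<Sum>n<p. (n choose k) * (n + l choose l)))
      - of_nat p * (F * G * ((- 1) ^ (k + l) / of_nat (Suc (k + l)))) \<in> padic_ideal 2"
proof -
  define S where "S = (\<Sum>n<p. (n choose k) * (n + l choose l))"
  define m where "m = Suc (k + l)"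
  define b where "b = (p - 1 choose k) * (p + l choose l)"
  define w where "w = (of_nat S - of_nat p * (- 1) ^ k / of_nat m :: 'p padic)"
  have prime: "prime p" unfolding p_def by (rule prime_card)
  have m0: "(of_nat m :: 'p padic) \<noteq> 0" by (simp add: m_def del: of_nat_Suc)
  have p0: "(of_nat p :: 'p padic) \<noteq> 0" using prime by (simp add: prime_gt_0_nat)
  have "m * S = p * b"
    using sum_binomial_product[of k l p] by (simp add: S_def m_def b_def mult.assoc)
  hence mS: "of_nat m * of_nat S = (of_nat p * of_nat b :: 'p padic)"
    by (metis of_nat_mult)
  have inv_m: "inverse (of_nat m :: 'p padic) \<in> padic_ideal 0" if "\<not> p dvd m"
    using that inverse_of_nat_in_ideal[of m, where 'p = 'p] by (simp add: p_def)
  have w: "w = of_nat p * of_int (int b - (- 1) ^ k) * inverse (of_nat m)"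
    using mS m0 by (simp add: w_def field_simps)
  have "F * w \<in> padic_ideal 2"
  proof (cases "k = p")
    case False
    hence k: "k < p" using kl by simp
    have "w \<in> padic_ideal 2"
    proof (cases "p dvd m")
      case True
      then obtain c where c: "m = p * c" by (elim dvdE)
      have "0 < m" "m < p * 2" using k kl by (simp_all add: m_def)
      hence "c = 1" unfolding c by auto
      hence m: "m = p" by (simp add: c)
      hence "k = p - 1 - l" "l = p - 1 - k" using k kl by (auto simp: m_def)
      hence "(p - 1 choose k) = (p - 1 choose l)"
        by (metis binomial_symmetric diff_le_self)
      moreover have "(- 1 :: int) ^ k = (- 1) ^ l"
      proof -
        have "even (k + l)" using m odd unfolding m_def by (metis even_Suc)
        thus ?thesis by (simp add: minus_one_power_iff)
      qed
      ultimately have "[int b = (- 1) ^ k] (mod int p ^ 2)"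
        using binomial_product_cong_square[OF prime kl(2)] by (simp add: b_def)
      hence "(of_int (int b - (- 1) ^ k) :: 'p padic) \<in> padic_ideal 2"
        unfolding cong_iff_dvd_diff p_def by (rule of_int_in_ideal)
      moreover have "w = of_int (int b - (- 1) ^ k)"
        unfolding w m using p0 by simp
      ultimately show ?thesis by (simp only:)
    next
      case False
      have "[int b = (- 1) ^ k * 1] (mod int p)"
        unfolding b_def of_nat_mult
        by (intro cong_mult binomial_pred_prime_cong binomial_prime_add_cong prime k kl)
      hence "(of_int (int b - (- 1) ^ k) :: 'p padic) \<in> padic_ideal 1"
        by (intro of_int_in_ideal) (simp add: cong_iff_dvd_diff p_def)
      from padic_ideal_mult[OF of_nat_card_in_ideal this]
      have "(of_nat p * of_int (int b - (- 1) ^ k) :: 'p padic) \<in> padic_ideal 2"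
        by (simp add: p_def numeral_2_eq_2)
      thus ?thesis unfolding w by (rule padic_ideal_mult_right) (rule inv_m[OF False])
    qed
    thus ?thesis by (rule padic_ideal_mult_left[OF F(1)])
  next
    case True
    have "of_nat p * inverse (of_nat m :: 'p padic) \<in> padic_ideal 0"
    proof (cases "p dvd m")
      case True
      then obtain c where c: "m = p * c" by (elim dvdE)
      have "p * 1 < m" "m \<le> p * 2" using \<open>k = p\<close> kl by (simp_all add: m_def)
      hence "1 < c" "c \<le> 2" using prime_gt_0_nat[OF prime] unfolding c by simp_all
      hence "m = p * 2" by (simp add: c)
      hence "of_nat p * inverse (of_nat m :: 'p padic) = inverse (of_nat 2)"
        using p0 by (simp add: field_simps)
      moreover have "\<not> p dvd 2"
        using odd prime by (metis dvd_refl primes_dvd_imp_eq two_is_prime_nat)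
      ultimately show ?thesis
        using inverse_of_nat_in_ideal[of 2, where 'p = 'p] by (simp only: p_def simp_thms)
    qed (simp add: inv_m padic_ideal_mult_left)
    hence "of_int (int b - (- 1) ^ k) * (of_nat p * inverse (of_nat m :: 'p padic)) \<in> padic_ideal 0"
      by (rule padic_ideal_mult_left[OF of_int_in_ideal_0])
    hence "w \<in> padic_ideal 0" unfolding w by (simp only: mult_ac)
    thus ?thesis by (rule padic_ideal_mult_right[OF F(2)[OF True]])
  qed
  hence "F * w * (G * (- 1) ^ l) \<in> padic_ideal 2"
    by (rule padic_ideal_mult_right) (intro padic_ideal_mult_left G padic_ideal_power, simp)
  also have "F * w * (G * (- 1) ^ l) = F * G * ((- 1) ^ l * of_nat S)
      - of_nat p * (F * G * ((- 1) ^ (k + l) / of_nat m))"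
    by (simp add: w_def power_add algebra_simps)
  finally show ?thesis unfolding S_def m_def .
qed

text \<open>This coefficient can be nonzero only for a = p - 1. Differentiation then gives one
  factor p and the central binomial coefficient the other.\<close>

lemma coeff_legendre_left_prime:
  fixes a :: nat
  defines "p \<equiv> CARD('p :: prime_card)"
  assumes "a < p"
  shows "(coeff (legendre_left a) p :: 'p padic) \<in> padic_ideal 2"
proof -
  have prime: "prime p" unfolding p_def by (rule prime_card)
  hence p: "p > 0" by (rule prime_gt_0_nat)
  define b where "b = (a choose (p - 1)) * (a + (p - 1) choose (p - 1))"
  have "p dvd b"
  proof (cases "a = p - 1")
    case True
    thus ?thesis using prime_dvd_central_binomial[OF prime] by (simp add: b_def mult_2)
  next
    case False
    thus ?thesis using \<open>a < p\<close> by (simp add: b_def binomial_eq_0)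
  qed
  hence "int p ^ 2 dvd int (p * 2 ^ (p - 1) * b)"
    by (auto simp: power2_eq_square elim!: dvdE)
  hence "(of_int (int (p * 2 ^ (p - 1) * b)) :: 'p padic) \<in> padic_ideal 2"
    unfolding p_def by (rule of_int_in_ideal)
  moreover have "(coeff (legendre_left a) p :: 'p padic) = of_int (int (p * 2 ^ (p - 1) * b))"
    using p \<open>a < p\<close> by (simp add: coeff_legendre_left coeff_shifted_legendre b_def binomial_eq_0)
  ultimately show ?thesis by (simp only:)
qed

lemma sum_dual_sum_cong:
  fixes a :: nat
  defines "p \<equiv> CARD('p :: prime_card)"
  assumes "odd p" "a < p"
  shows "(\<Sum>n<p. of_nat (n + 1) * dual_sum a n ^ 2)
     - of_nat p * (1 / 4 - (- 1) ^ a * (2 * of_nat a ^ 2 + 2 * of_nat a - 1) / (4 * of_nat (2 * a + 1)))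
     \<in> (padic_ideal 2 :: 'p padic set)"
  unfolding sum_dual_sum_square poly_int_left_right[symmetric] poly_int_def coeff_pairing_mult
    sum_distrib_left sum_subtractf[symmetric] p_def
proof (intro padic_ideal_sum binomial_term_cong)
  fix k l
  assume k: "k \<in> {..degree (legendre_left a :: 'p padic poly)}"
    and l: "l \<in> {..degree (legendre_right a :: 'p padic poly)}"
  show "k \<le> CARD('p)" "l < CARD('p)"
    using k l degree_legendre_left[of a, where 'a = "'p padic"]
      degree_legendre_right[of a, where 'a = "'p padic"] \<open>a < p\<close> by (auto simp: p_def)
  show "(coeff (legendre_left a) k :: 'p padic) \<in> padic_ideal 2" if "k = CARD('p)"
    using coeff_legendre_left_prime[of a, where 'p = 'p] \<open>a < p\<close> that by (simp add: p_def)
qed (use assms in \<open>auto intro: Ints_subset_padic_ideal coeff_legendre_left_in_Ints coeff_legendre_right_in_Ints\<close>)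

section \<open>Dependence on the argument modulo p^2\<close>

definition gen_dual_sum :: "'a :: field_char_0 \<Rightarrow> nat \<Rightarrow> 'a" where
  "gen_dual_sum x n
     = (\<Sum>k\<le>n. of_nat (n choose k) * (x gchoose k) * ((x + of_nat k) gchoose k) * 2 ^ k)"

lemma t_poly_eq: "t_poly n x = gen_dual_sum (to_fract x) n"
  by (simp add: t_poly_def gen_dual_sum_def)

lemma gen_dual_sum_of_nat: "gen_dual_sum (of_nat a) n = dual_sum a n"
  unfolding gen_dual_sum_def dual_sum_altdef
  by (simp add: binomial_gbinomial)

text \<open>Negating the upper index exchanges the two binomials in x, and the two signs (-1)^k
  cancel.\<close>

lemma gen_dual_sum_reflect: "gen_dual_sum (- 1 - x) n = gen_dual_sum x n"
proof -
  have "((- 1 - x) gchoose k) * ((- 1 - x + of_nat k) gchoose k)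
      = (x gchoose k) * ((x + of_nat k) gchoose k)" for k
    using gbinomial_negated_upper[of "- 1 - x" k] gbinomial_negated_upper[of "- 1 - x + of_nat k" k]
    by (simp add: algebra_simps flip: power_mult_distrib)
  thus ?thesis by (simp add: gen_dual_sum_def mult.assoc)
qed

text \<open>The values \<open>u\<close>, \<open>v\<close>, \<open>w\<close> behave like those of an integral polynomial at \<open>a + p y\<close>, \<open>a\<close>
  and \<open>a - p\<close>: modulo \<open>p\<^sup>2\<close> such a polynomial is affine in \<open>y\<close>.\<close>

definition affine_triple :: "'p :: prime_card padic \<Rightarrow> 'p padic \<Rightarrow> 'p padic \<Rightarrow> 'p padic \<Rightarrow> bool" where
  "affine_triple y u v w \<longleftrightarrow>
     v \<in> padic_ideal 0 \<and> v - w \<in> padic_ideal 1 \<and> u - (v + y * (v - w)) \<in> padic_ideal 2"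

lemma affine_triple_const: "c \<in> padic_ideal 0 \<Longrightarrow> affine_triple y c c c"
  by (simp add: affine_triple_def)

lemma affine_triple_add:
  assumes "affine_triple y u v w" "affine_triple y u' v' w'"
  shows "affine_triple y (u + u') (v + v') (w + w')"
proof -
  have "v + v' - (w + w') = (v - w) + (v' - w')"
    "u + u' - (v + v' + y * (v + v' - (w + w'))) = (u - (v + y * (v - w))) + (u' - (v' + y * (v' - w')))"
    by (simp_all add: algebra_simps)
  thus ?thesis using assms unfolding affine_triple_def by (simp only: padic_ideal_add)
qed

text \<open>With u = v + y d + e and w = v - d, the defect of the product is d d' (y^2 + y) plus
  multiples of e and e'. Both d and d' are divisible by p.\<close>

lemma affine_triple_mult:
  assumes y: "y \<in> padic_ideal 0" and "affine_triple y u v w" "affine_triple y u' v' w'"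
  shows "affine_triple y (u * u') (v * v') (w * w')"
proof -
  define d d' e e' where d: "d = v - w" "d' = v' - w'" "e = u - (v + y * d)" "e' = u' - (v' + y * d')"
  note defs = this
  have v: "v \<in> padic_ideal 0" "v' \<in> padic_ideal 0"
    and d: "d \<in> padic_ideal 1" "d' \<in> padic_ideal 1" and e: "e \<in> padic_ideal 2" "e' \<in> padic_ideal 2"
    using assms by (simp_all add: affine_triple_def defs)
  have d0: "d \<in> padic_ideal 0" "d' \<in> padic_ideal 0"
    using d padic_ideal_Suc_subset[of _ 0] by auto
  have e0: "e \<in> padic_ideal 0" "e' \<in> padic_ideal 0"
    using e padic_ideal_Suc_subset[of _ 0] padic_ideal_Suc_subset[of _ 1] by (auto simp: numeral_2_eq_2)
  have dd: "d * d' \<in> padic_ideal 2"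
    using padic_ideal_mult[OF d] by (simp add: numeral_2_eq_2)
  have w: "w = v - d" "w' = v' - d'" and u: "u = v + y * d + e" "u' = v' + y * d' + e'"
    by (simp_all add: defs)
  have "v * v' - w * w' = v * d' + d * (v' - d')"
    by (simp add: w algebra_simps)
  also have "\<dots> \<in> padic_ideal 1"
    by (intro padic_ideal_add padic_ideal_mult_left[OF v(1)] padic_ideal_mult_right d padic_ideal_diff v d0)
  finally have 1: "v * v' - w * w' \<in> padic_ideal 1" .
  have "u * u' - (v * v' + y * (v * v' - w * w'))
      = d * d' * (y * y + y) + e * (v' + y * d' + e') + (v + y * d) * e'"
    by (simp add: w u algebra_simps)
  also have "\<dots> \<in> padic_ideal 2"
    by (intro padic_ideal_add padic_ideal_mult_right[OF dd] padic_ideal_mult_right[OF e(1)]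
        padic_ideal_mult_left[OF _ e(2)] padic_ideal_mult_left[OF y] y v d0 e0)
  finally show ?thesis
    using 1 padic_ideal_mult_left[OF v] by (simp add: affine_triple_def)
qed

lemma affine_triple_sum:
  "(\<And>i. i \<in> A \<Longrightarrow> affine_triple y (f i) (g i) (h i)) \<Longrightarrow> affine_triple y (sum f A) (sum g A) (sum h A)"
  by (induction A rule: infinite_finite_induct) (simp_all add: affine_triple_add affine_triple_const)

lemma affine_triple_prod:
  "y \<in> padic_ideal 0 \<Longrightarrow> (\<And>i. i \<in> A \<Longrightarrow> affine_triple y (f i) (g i) (h i))
     \<Longrightarrow> affine_triple y (prod f A) (prod g A) (prod h A)"
  by (induction A rule: infinite_finite_induct) (simp_all add: affine_triple_mult affine_triple_const)

text \<open>For k < p the denominator k! is a p-adic unit, so the binomial is an integral polynomial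
  in its argument.\<close>

lemma affine_triple_gbinomial:
  fixes y :: "'p :: prime_card padic"
  assumes y: "y \<in> padic_ideal 0" and t: "affine_triple y u v w" and k: "k < CARD('p)"
  shows "affine_triple y (u gchoose k) (v gchoose k) (w gchoose k)"
proof -
  have "\<not> CARD('p) dvd fact k"
    using k prime_dvd_fact_iff[OF prime_card[where 'a = 'p]] by simp
  hence "inverse (of_nat (fact k) :: 'p padic) \<in> padic_ideal 0"
    by (rule inverse_of_nat_in_ideal)
  hence "affine_triple y (inverse (fact k)) (inverse (fact k)) (inverse (fact k))"
    by (intro affine_triple_const) simp
  moreover have "affine_triple y (\<Prod>i=0..<k. u - of_nat i) (\<Prod>i=0..<k. v - of_nat i) (\<Prod>i=0..<k. w - of_nat i)"
    using affine_triple_add[OF t affine_triple_const[of "- of_nat _"]]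
    by (intro affine_triple_prod y) (simp add: padic_ideal_minus)
  ultimately show ?thesis
    unfolding gbinomial_prod_rev divide_inverse by (rule affine_triple_mult[OF y, rotated])
qed

lemma affine_triple_gen_dual_sum:
  fixes y :: "'p :: prime_card padic"
  assumes y: "y \<in> padic_ideal 0" and t: "affine_triple y u v w" and n: "n < CARD('p)"
  shows "affine_triple y (gen_dual_sum u n) (gen_dual_sum v n) (gen_dual_sum w n)"
  unfolding gen_dual_sum_def
proof (rule affine_triple_sum)
  fix k assume "k \<in> {..n}"
  hence k: "k < CARD('p)" using n by simp
  have "affine_triple y (u + of_nat k) (v + of_nat k) (w + of_nat k)"
    by (rule affine_triple_add[OF t affine_triple_const]) simp
  thus "affine_triple y (of_nat (n choose k) * (u gchoose k) * (u + of_nat k gchoose k) * 2 ^ k)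
     (of_nat (n choose k) * (v gchoose k) * (v + of_nat k gchoose k) * 2 ^ k)
     (of_nat (n choose k) * (w gchoose k) * (w + of_nat k gchoose k) * 2 ^ k)"
    by (intro affine_triple_mult y affine_triple_gbinomial t k affine_triple_const
        padic_ideal_power) simp_all
qed

definition weighted_sum :: "'p :: prime_card padic \<Rightarrow> 'p padic" where
  "weighted_sum x = (\<Sum>n<CARD('p). of_nat (n + 1) * gen_dual_sum x n ^ 2)"

text \<open>The integral of \<open>poly_int_left_right\<close>. Its denominator contains 2a + 1,
  which equals p in the case x = -1/2 modulo p; it is therefore always used with a factor p.\<close>

definition residue_value :: "nat \<Rightarrow> 'a :: field_char_0" where
  "residue_value a
     = 1 / 4 - (- 1) ^ a * (2 * of_nat a ^ 2 + 2 * of_nat a - 1) / (4 * of_nat (2 * a + 1))"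

lemma weighted_sum_of_nat:
  assumes "odd CARD('p)" "a < CARD('p)"
  shows "weighted_sum (of_nat a) - of_nat CARD('p) * residue_value a
     \<in> (padic_ideal 2 :: 'p :: prime_card padic set)"
  unfolding weighted_sum_def residue_value_def gen_dual_sum_of_nat
  by (rule sum_dual_sum_cong[OF assms])

lemma weighted_sum_cong:
  fixes y :: "'p :: prime_card padic"
  assumes odd: "odd CARD('p)" and a: "a < CARD('p)" and y: "y \<in> padic_ideal 0"
  defines "b \<equiv> CARD('p) - 1 - a"
  defines "A \<equiv> of_nat CARD('p) * residue_value a" and "B \<equiv> of_nat CARD('p) * residue_value b"
  shows "weighted_sum (of_nat a + of_nat CARD('p) * y) - (A + y * (A - B)) \<in> padic_ideal 2"
proof -
  let ?F = "weighted_sum :: 'p padic \<Rightarrow> 'p padic"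
  let ?x = "of_nat a + of_nat CARD('p) * y"
  have "affine_triple y ?x (of_nat a) (of_nat a - of_nat CARD('p))"
    by (simp add: affine_triple_def mult.commute)
      (simp only: One_nat_def[symmetric] of_nat_card_in_ideal)
  hence "affine_triple y (?F ?x) (?F (of_nat a)) (?F (of_nat a - of_nat CARD('p)))"
    unfolding weighted_sum_def power2_eq_square
    by (intro affine_triple_sum affine_triple_mult y affine_triple_const affine_triple_gen_dual_sum
        of_nat_in_ideal_0) simp_all
  \<comment> \<open>The reflection brings a - p back to the range from 0 to p - 1, where the
    evaluation at natural numbers applies.\<close>
  moreover have "?F (of_nat a - of_nat CARD('p)) = ?F (of_nat b)"
  proof -
    have "of_nat a - of_nat CARD('p) = - 1 - (of_nat b :: 'p padic)"
      using a by (simp add: b_def of_nat_diff)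
    thus ?thesis by (simp only: weighted_sum_def gen_dual_sum_reflect)
  qed
  ultimately have 1: "?F ?x - (?F (of_nat a) + y * (?F (of_nat a) - ?F (of_nat b))) \<in> padic_ideal 2"
    by (simp add: affine_triple_def)
  have FA: "?F (of_nat a) - A \<in> padic_ideal 2"
    unfolding A_def by (rule weighted_sum_of_nat[OF odd a])
  have FB: "?F (of_nat b) - B \<in> padic_ideal 2"
    unfolding B_def by (rule weighted_sum_of_nat[OF odd]) (use a in \<open>simp add: b_def\<close>)
  have "?F ?x - (A + y * (A - B)) = (?F ?x - (?F (of_nat a) + y * (?F (of_nat a) - ?F (of_nat b))))
      + ((?F (of_nat a) - A) + y * ((?F (of_nat a) - A) - (?F (of_nat b) - B)))"
    by (simp add: algebra_simps)
  also have "\<dots> \<in> padic_ideal 2"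
    by (intro padic_ideal_add padic_ideal_diff padic_ideal_mult_left 1 FA FB y)
  finally show ?thesis .
qed

lemma least_residue_decomposition:
  fixes x :: "'p :: prime_card padic_int"
  obtains y where "y \<in> padic_ideal 0" "least_residue x < CARD('p)"
    "to_fract x = of_nat (least_residue x) + of_nat CARD('p) * y"
proof -
  have r: "padic_residue x 1 \<in> {0..<int CARD('p)}"
    using padic_residue[of x] by (auto dest: spec[of _ 1])
  hence "padic_residue x 1 = int (least_residue x)" and lt: "least_residue x < CARD('p)"
    by (auto simp: least_residue_eq)
  hence "padic_cong (to_fract x) (of_nat (least_residue x)) CARD('p)"
    by (simp add: padic_cong_of_nat_iff)
  then obtain z where "to_fract x - of_nat (least_residue x) = of_nat CARD('p) * to_fract z"
    by (auto simp: padic_cong_def)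
  thus ?thesis using lt by (intro that[of "to_fract z"]) (simp_all add: algebra_simps)
qed

section \<open>Comparison with the closed form\<close>

lemma inverse_2_in_ideal:
  assumes "odd CARD('p)"
  shows "(1 / 2 :: 'p :: prime_card padic) \<in> padic_ideal 0"
proof -
  have "\<not> CARD('p) dvd 2"
    using assms by (metis primes_dvd_imp_eq two_is_prime_nat prime_card)
  from inverse_of_nat_in_ideal[OF this] show ?thesis by (simp add: inverse_eq_divide)
qed

text \<open>All terms carry a factor p, so congruences modulo p suffice: 2a + 1 is 2x + 1, 2b + 1 is
  -(2x + 1), and the quadratic factors at a and b both agree with that at x.\<close>

lemma residue_value_cong:
  fixes y :: "'p :: prime_card padic"
  assumes odd: "odd CARD('p)" and a: "a < CARD('p)" and y: "y \<in> padic_ideal 0"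
  defines "b \<equiv> CARD('p) - 1 - a"
  defines "A \<equiv> of_nat CARD('p) * residue_value a" and "B \<equiv> of_nat CARD('p) * residue_value b"
  defines "x \<equiv> of_nat a + of_nat CARD('p) * y"
  assumes unit: "2 * x + 1 \<notin> padic_ideal 1"
  shows "A + y * (A - B) - (of_nat CARD('p) / 4 - (- 1) ^ a * (2 * x ^ 2 + 2 * x - 1)
      * (of_nat CARD('p) * (1 + 2 * y)) / (8 * x + 4)) \<in> padic_ideal 2"
proof -
  define p where "p = (of_nat CARD('p) :: 'p padic)"
  define s t where "s = (of_nat (2 * a + 1) :: 'p padic)" and "t = (of_nat (2 * b + 1) :: 'p padic)"
  define V v v' where "V = inverse (2 * x + 1)" and "v = inverse s" and "v' = inverse t"
  define R q q' where "R = 2 * x ^ 2 + 2 * x - 1"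
    and "q = (2 * of_nat a ^ 2 + 2 * of_nat a - 1 :: 'p padic)"
    and "q' = (2 * of_nat b ^ 2 + 2 * of_nat b - 1 :: 'p padic)"
  define e where "e = (- 1 :: 'p padic) ^ a"
  have p1: "p \<in> padic_ideal 1" unfolding p_def by (rule of_nat_card_in_ideal)
  have x_eq: "x = of_nat a + p * y" by (simp add: x_def p_def)
  have b_eq: "of_nat b = p - 1 - (of_nat a :: 'p padic)"
    using a by (simp add: b_def p_def of_nat_diff)
  have e_b: "(- 1 :: 'p padic) ^ b = e"
  proof -
    have "even (a + b)" using a odd by (simp add: b_def)
    thus ?thesis by (auto simp: e_def minus_one_power_iff)
  qed
  have py: "p * y \<in> padic_ideal 1" by (rule padic_ideal_mult_right[OF p1 y])
  have x0: "x \<in> padic_ideal 0"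
    unfolding x_def by (intro padic_ideal_add padic_ideal_mult_left y of_nat_in_ideal_0)
  have R0: "R \<in> padic_ideal 0"
    unfolding R_def by (intro padic_ideal_add padic_ideal_diff padic_ideal_mult_left padic_ideal_power x0) simp_all
  have half: "(1 / 2 :: 'p padic) \<in> padic_ideal 0" by (rule inverse_2_in_ideal[OF odd])
  have sx: "2 * x + 1 - s \<in> padic_ideal 1"
  proof -
    have "2 * x + 1 - s = 2 * (p * y)" by (simp add: s_def x_eq)
    thus ?thesis using padic_ideal_mult_left[OF _ py, of 2] by simp
  qed
  have tx: "2 * x + 1 + t \<in> padic_ideal 1"
  proof -
    have "2 * x + 1 + t = 2 * (p * y + p)" by (simp add: t_def x_eq b_eq algebra_simps)
    thus ?thesis using padic_ideal_mult_left[OF _ padic_ideal_add[OF py p1], of 2] by simp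
  qed
  have s: "s \<notin> padic_ideal 1"
    using unit padic_ideal_add[OF sx, of s] by auto
  have t: "t \<notin> padic_ideal 1"
    using unit padic_ideal_diff[OF tx, of t] by auto
  have V: "V \<in> padic_ideal 0"
    unfolding V_def
    by (rule inverse_in_padic_ideal[OF _ unit]) (intro padic_ideal_add padic_ideal_mult_left x0, simp_all)
  have v: "v \<in> padic_ideal 0"
    unfolding v_def by (rule inverse_in_padic_ideal[OF _ s]) (simp only: s_def of_nat_in_ideal_0)
  have v': "v' \<in> padic_ideal 0"
    unfolding v'_def by (rule inverse_in_padic_ideal[OF _ t]) (simp only: t_def of_nat_in_ideal_0)
  have nz: "s \<noteq> 0" "t \<noteq> 0" "2 * x + 1 \<noteq> 0"
    using s t unit by (metis padic_ideal_0)+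
  have "v - V = (2 * x + 1 - s) * (v * V)"
    using nz by (simp add: v_def V_def field_simps)
  hence vV: "v - V \<in> padic_ideal 1"
    using padic_ideal_mult_right[OF sx padic_ideal_mult_left[OF v V]] by (simp only:)
  have "v' + V = (2 * x + 1 + t) * (v' * V)"
    using nz by (simp add: v'_def V_def field_simps)
  hence v'V: "v' + V \<in> padic_ideal 1"
    using padic_ideal_mult_right[OF tx padic_ideal_mult_left[OF v' V]] by (simp only:)
  have "q - R = p * y * - (2 * (of_nat a + x + 1))"
    by (simp add: q_def R_def x_eq algebra_simps power2_eq_square)
  moreover have "\<dots> \<in> padic_ideal 1"
    by (intro padic_ideal_mult_right[OF py] padic_ideal_minus padic_ideal_mult_left padic_ideal_add x0)
      simp_all
  ultimately have qR: "q - R \<in> padic_ideal 1" by (simp only:)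
  have "q' - R = (p + p * y) * (2 * (of_nat b - x))"
    by (simp add: q'_def R_def x_eq b_eq algebra_simps power2_eq_square)
  moreover have "\<dots> \<in> padic_ideal 1"
    by (intro padic_ideal_mult_right[OF padic_ideal_add[OF p1 py]] padic_ideal_mult_left
        padic_ideal_diff x0) simp_all
  ultimately have q'R: "q' - R \<in> padic_ideal 1" by (simp only:)
  \<comment> \<open>The errors of replacing q v by R V and q' v' by -R V. The opposite signs turn y
    (A - B) into the summand 2 y of the factor 1 + 2 y.\<close>
  define D D' where "D = q * v - R * V" and "D' = q' * v' + R * V"
  have "D = (q - R) * v + R * (v - V)" "D' = (q' - R) * v' + R * (v' + V)"
    by (simp_all add: D_def D'_def algebra_simps)
  hence D: "D \<in> padic_ideal 1" "D' \<in> padic_ideal 1"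
    using qR q'R vV v'V v v' R0
    by (simp_all only: padic_ideal_add padic_ideal_mult_left padic_ideal_mult_right)
  have "A + y * (A - B) - (p / 4 - e * R * (p * (1 + 2 * y)) / (8 * x + 4))
      = p * ((D * (1 + y) - y * D') * (- e * (1 / 2 * (1 / 2))))"
  proof -
    have "A = p * (1 / 4 - e * q / (4 * s))" "B = p * (1 / 4 - e * q' / (4 * t))"
      by (simp_all only: A_def B_def residue_value_def p_def e_def[symmetric] e_b q_def q'_def
          s_def t_def)
    hence 1: "A = p / 4 - e * p * q * v / 4" "B = p / 4 - e * p * q' * v' / 4"
      using nz by (simp_all add: v_def v'_def field_simps)
    have 2: "e * R * (p * (1 + 2 * y)) / (8 * x + 4) = e * R * (p * (1 + 2 * y)) * V / 4"
    proof -
      have "8 * x + 4 = 4 * (2 * x + 1)" by simp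
      thus ?thesis unfolding V_def by (simp only: divide_inverse inverse_mult_distrib mult_ac)
    qed
    show ?thesis unfolding 1 2 D_def D'_def by (simp add: field_simps)
  qed
  also have "\<dots> \<in> padic_ideal (1 + 1)"
    by (intro padic_ideal_mult[OF p1] padic_ideal_mult_right padic_ideal_mult_left half padic_ideal_diff
        padic_ideal_minus padic_ideal_power D y padic_ideal_add)
      (simp_all add: e_def y padic_ideal_power padic_ideal_minus D padic_ideal_mult_left)
  finally show ?thesis
    unfolding p_def e_def R_def by (simp add: numeral_2_eq_2)
qed

text \<open>Euler's criterion gives the congruence modulo p. The two sides differ by at most 2, less
  than the odd prime p, so they are equal.\<close>

lemma Legendre_minus_1:
  assumes "prime p" "p = 2 * a + 1"
  shows "Legendre (- 1) (int p) = (- 1) ^ a"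
proof -
  have "[Legendre (- 1) (int p) = (- 1) ^ ((p - 1) div 2)] (mod int p)"
    using assms prime_ge_2_nat[OF assms(1)] by (intro euler_criterion) auto
  hence "int p dvd Legendre (- 1) (int p) - (- 1) ^ a"
    by (simp add: assms(2) cong_iff_dvd_diff)
  moreover have "\<bar>Legendre (- 1) (int p) - (- 1) ^ a\<bar> < int p"
    using prime_ge_2_nat[OF assms(1)] assms(2) by (auto simp: Legendre_def minus_one_power_iff)
  ultimately show ?thesis by (metis dvd_imp_le_int abs_of_nat eq_iff_diff_eq_0 not_le)
qed

theorem theorem1p2:
  fixes p :: nat
  assumes p: "p = CARD('p :: prime_card)" and odd: "odd p"
  shows "(\<forall>x :: 'p padic_int. \<not> padic_cong (to_fract x) (- 1 / 2) p \<longrightarrow>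
           padic_cong (\<Sum>n = 0..p - 1. of_nat (n + 1) * t_poly n x ^ 2)
             (of_nat p / 4
               - (- 1) ^ least_residue x * (2 * to_fract x ^ 2 + 2 * to_fract x - 1)
                   * (of_nat p + 2 * (to_fract x - of_nat (least_residue x)))
                 / (8 * to_fract x + 4))
             (p ^ 2)) \<and>
         (\<forall>x :: 'p padic_int. padic_cong (to_fract x) (- 1 / 2) p \<longrightarrow>
           padic_cong (\<Sum>n = 0..p - 1. of_nat (n + 1) * t_poly n x ^ 2)
             (of_nat p / 4 + 3 / 8 * of_int (Legendre (- 1) (int p)))
             (p ^ 2))"
proof (intro conjI allI impI)
  fix x :: "'p padic_int"
  define a where "a = least_residue x"
  obtain y where y: "y \<in> padic_ideal 0" and a: "a < CARD('p)"
    and x: "to_fract x = of_nat a + of_nat CARD('p) * y"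
    unfolding a_def by (rule least_residue_decomposition)
  have odd': "odd CARD('p)" using odd by (simp add: p)
  have half: "(1 / 2 :: 'p padic) \<in> padic_ideal 0" by (rule inverse_2_in_ideal[OF odd'])
  have "{0..p - 1} = {..<CARD('p)}"
    using prime_gt_0_nat[OF prime_card[where 'a = 'p]] unfolding p
    by (metis Suc_diff_1 atLeast0AtMost lessThan_Suc_atMost)
  hence sum: "(\<Sum>n = 0..p - 1. of_nat (n + 1) * t_poly n x ^ 2) = weighted_sum (to_fract x)"
    by (simp add: weighted_sum_def t_poly_eq)
  have F: "weighted_sum (to_fract x)
      - (of_nat CARD('p) * residue_value a + y * (of_nat CARD('p) * residue_value a
          - of_nat CARD('p) * residue_value (CARD('p) - 1 - a))) \<in> padic_ideal 2"
    unfolding x by (rule weighted_sum_cong[OF odd' a y])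
  have cong_1: "padic_cong (to_fract x) (- 1 / 2) p \<longleftrightarrow> 2 * to_fract x + 1 \<in> padic_ideal 1"
  proof -
    have "padic_cong (to_fract x) (- 1 / 2) p \<longleftrightarrow> to_fract x + 1 / 2 \<in> padic_ideal 1"
      using padic_cong_iff_ideal[of "to_fract x" "- 1 / 2" 1] by (simp add: p)
    moreover have "2 * to_fract x + 1 \<in> padic_ideal 1" if "to_fract x + 1 / 2 \<in> padic_ideal 1"
      using padic_ideal_mult_left[OF padic_ideal_0_simps(3)[of "num.Bit0 num.One"] that]
      by (simp add: distrib_left)
    moreover have "to_fract x + 1 / 2 \<in> padic_ideal 1" if "2 * to_fract x + 1 \<in> padic_ideal 1"
      using padic_ideal_mult_left[OF half that] by (simp add: distrib_left)
    ultimately show ?thesis by blast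
  qed
  {
    assume "\<not> padic_cong (to_fract x) (- 1 / 2) p"
    hence unit: "2 * (of_nat a + of_nat CARD('p) * y) + 1 \<notin> padic_ideal 1"
      using cong_1 unfolding x by blast
    have eq: "of_nat CARD('p) + 2 * (to_fract x - of_nat a) = of_nat CARD('p) * (1 + 2 * y)"
      unfolding x by (simp add: algebra_simps)
    show "padic_cong (\<Sum>n = 0..p - 1. of_nat (n + 1) * t_poly n x ^ 2)
             (of_nat p / 4
               - (- 1) ^ least_residue x * (2 * to_fract x ^ 2 + 2 * to_fract x - 1)
                   * (of_nat p + 2 * (to_fract x - of_nat (least_residue x)))
                 / (8 * to_fract x + 4))
             (p ^ 2)"
      unfolding sum a_def[symmetric] unfolding p padic_cong_iff_ideal eq
      by (rule padic_ideal_diff_trans[OF F residue_value_cong[OF odd' a y unit, folded x]])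
  next
    assume "padic_cong (to_fract x) (- 1 / 2) p"
    hence "2 * to_fract x + 1 \<in> padic_ideal 1" unfolding cong_1 .
    moreover have "2 * of_nat CARD('p) * y \<in> padic_ideal 1"
      by (intro padic_ideal_mult_right padic_ideal_mult_left of_nat_card_in_ideal y) simp
    ultimately have "2 * to_fract x + 1 - 2 * of_nat CARD('p) * y \<in> padic_ideal 1"
      by (rule padic_ideal_diff)
    also have "2 * to_fract x + 1 - 2 * of_nat CARD('p) * y = of_nat (2 * a + 1)"
      by (simp add: x)
    finally have "CARD('p) dvd 2 * a + 1" unfolding of_nat_in_ideal_1_iff .
    then obtain c where c: "2 * a + 1 = CARD('p) * c" by (elim dvdE)
    have "0 < CARD('p) * c" "CARD('p) * c < CARD('p) * 2" using a by (simp_all flip: c)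
    \<comment> \<open>The number 2a + 1 is a positive multiple of p below 2p.\<close>
    hence "c = 1" by auto
    hence pa: "p = 2 * a + 1" using c by (simp add: p)
    have p0: "(of_nat p :: 'p padic) \<noteq> 0" by (simp add: pa del: of_nat_Suc)
    have leg: "Legendre (- 1) (int p) = (- 1) ^ a"
      using Legendre_minus_1[OF _ pa] prime_card[where 'a = 'p] by (simp add: p)
    \<comment> \<open>The reflected residue is a itself, so the term linear in y vanishes.\<close>
    have "CARD('p) - 1 - a = a" using pa by (simp flip: p)
    hence "weighted_sum (to_fract x) - of_nat p * residue_value a \<in> padic_ideal 2"
      using F by (simp add: p)
    moreover have "of_nat p * residue_value a - (of_nat p / 4 + 3 / 8 * (- 1) ^ a)
        = of_nat CARD('p) ^ 2 * (- ((- 1) ^ a) * (1 / 2 * (1 / 2 * (1 / 2))) :: 'p padic)"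
    proof -
      have 1: "of_nat p * residue_value a
          = (of_nat p / 4 - (- 1) ^ a * (2 * of_nat a ^ 2 + 2 * of_nat a - 1) / 4 :: 'p padic)"
        unfolding residue_value_def pa[symmetric] using p0 by (simp add: field_simps)
      \<comment> \<open>Substituting a = (p - 1) / 2 leaves p^2 / 8 up to sign as the only
        discrepancy from the claimed value.\<close>
      have 2: "(2 * of_nat a ^ 2 + 2 * of_nat a - 1 :: 'p padic) = (of_nat p ^ 2 - 3) / 2"
        by (simp add: pa field_simps power2_eq_square)
      show ?thesis
        unfolding p[symmetric] 1 2 by (simp add: field_simps)
    qed
    moreover have "\<dots> \<in> padic_ideal 2"
    proof (rule padic_ideal_mult_right)
      show "of_nat CARD('p) ^ 2 \<in> (padic_ideal 2 :: 'p padic set)"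
        by (rule padic_idealI[of _ _ 1]) simp
    qed (intro padic_ideal_mult_left padic_ideal_minus padic_ideal_power half, simp)
    ultimately have "weighted_sum (to_fract x) - (of_nat p / 4 + 3 / 8 * (- 1) ^ a) \<in> padic_ideal 2"
      by (metis padic_ideal_diff_trans)
    thus "padic_cong (\<Sum>n = 0..p - 1. of_nat (n + 1) * t_poly n x ^ 2)
             (of_nat p / 4 + 3 / 8 * of_int (Legendre (- 1) (int p)))
             (p ^ 2)"
      unfolding leg sum unfolding p padic_cong_iff_ideal by simp
  }
qed

end
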